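(* (i) Let $S\equiv\pm\{1, 5, 6, 9, 13, 14, 16, 17, 20, 21, 25, 29\}\pmod{60}$ and $T\equiv\pm\{1, 4, 5, 11, 13, 14, 17, 19, 20, 25, 26, 29\}\pmod{60}$. Then $p(S,n)=p(T,n-1)$ for all $n\geq 1$. (ii) Let $S\equiv\pm\{1, 3, 5, 7, 8, 18, 20, 22, 23, 25, 27, 29\}\pmod{60}$ and $T\equiv\pm\{1, 2, 5, 7, 13, 17, 20, 22, 23, 25, 28, 29\}\pmod{60}$. Then $p(S,n)=p(T,n-1)$ for all $n\geq 1$. (iii) Let $S\equiv\pm\{4, 5, 6, 7, 9, 11, 19, 20, 21, 23, 25, 26\}\pmod{60}$ and $T\equiv\pm\{1, 5, 7, 11, 14, 16, 19, 20, 23, 25, 26, 29\}\pmod{60}$. Then $p(S,n)=p(T,n-4)$ for all $n\geq 4$. (iv) Let $S\equiv\pm\{2, 5, 7, 8, 11, 13, 17, 19, 20, 22, 23, 25\}\pmod{60}$ and $T\equiv\pm\{2, 3, 5, 11, 13, 17, 18, 19, 20, 25, 27, 28\}\pmod{60}$. Then $p(S,n)=p(T,n-2)$ for all $n\geq 2$.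
   Context: For a set $S$ of positive integers and an integer $n\ge 0$, $p(S,n)$ denotes the number of partitions of $n$ into parts belonging to $S$ (so $p(S,0)=1$). The notation $S\equiv\pm\{r_1,\dots,r_k\}\pmod M$ means that $S$ is the set of all positive integers $n$ such that $n\equiv r_i$ or $n\equiv -r_i\pmod M$ for some $i$. *)

theory Defs
  imports "HOL-Library.Multiset" "HOL-Number_Theory.Cong"
begin

definition pm_residues :: "int set \<Rightarrow> int \<Rightarrow> nat set" where
  "pm_residues R M = {n. n > 0 \<and> (\<exists>r\<in>R. [int n = r] (mod M) \<or> [int n = - r] (mod M))}"

(* A partition of n is the finite multiset of its parts.  This is meaningful only for sets S
   of positive integers: if 0 is in S and n is a sum of parts from S, then infinitely many
   multisets are counted and card returns 0. *)
definition num_partitions :: "nat set \<Rightarrow> nat \<Rightarrow> nat" where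
  "num_partitions S n = card {P :: nat multiset. set_mset P \<subseteq> S \<and> sum_mset P = n}"

end

theory Submission
  imports Defs "HOL-Complex_Analysis.Complex_Analysis"
begin

text \<open>
  Write \<open>\<theta>(z; p)\<close> for the product of the factors \<open>(1 - z p\<^sup>n) (1 - p\<^sup>n\<^sup>+\<^sup>1 / z)\<close> over all
  \<open>n \<ge> 0\<close>. All four shifted identities are specialisations of one identity in two variables:
  \[ \theta(w/z; w^3) \theta(w^4 z^4; w^{12}) - z \theta(w z; w^3) \theta(w^4/z^4; w^{12})
     = \theta(w; w^6) \theta(w^4; w^{12}) \theta(z; w) \theta(w^3/z^2; w^6). \]
  Both sides are divided by \<open>w\<^sup>6 z\<^sup>5\<close> under \<open>z \<mapsto> w\<^sup>3 z\<close>. In a fundamental annulus the right-hand side has the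
  five simple zeros \<open>1\<close>, \<open>w\<close>, \<open>w\<^sup>2\<close> and the two square roots of \<open>w\<^sup>3\<close>, at which the left-hand side vanishes
  too. So the quotient is holomorphic and invariant under \<open>z \<mapsto> w\<^sup>3 z\<close>, hence constant by the maximum modulus
  principle; the constant is found at \<open>z = \<i> w\<close>, where the second term on the left vanishes.
  Taking \<open>w = q\<^sup>5\<close> and \<open>z = q, q\<^sup>7, q\<^sup>4, q\<^sup>2\<close> and cancelling common factors turns the
  identity into \<open>F\<^sub>S(q) - q\<^sup>a F\<^sub>T(q) = 1\<close> for the generating functions in (i), (ii), (iii), (iv).
\<close>

section \<open>Infinite products and theta functions\<close>

lemma norm_power_less_one:
  fixes w :: complex
  assumes "norm w < 1" and "n > 0"
  shows "norm (w ^ n) < 1"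
  using assms by (simp add: norm_power power_less_one_iff)

text \<open>The infinite q-Pochhammer symbol (a; p), meaningful for |p| < 1. A vanishing factor
  makes its value zero.\<close>

definition qpoch :: "complex \<Rightarrow> complex \<Rightarrow> complex" where
  "qpoch a p = (\<Prod>n. 1 - a * p ^ n)"

lemma convergent_prod_qpoch:
  fixes a p :: complex
  assumes "norm p < 1"
  shows "convergent_prod (\<lambda>n. 1 - a * p ^ n)"
proof -
  have "summable (\<lambda>n. norm a * norm p ^ n)"
    using assms by (intro summable_mult summable_geometric) auto
  then have "summable (\<lambda>n. norm ((1 - a * p ^ n) - 1))"
    by (simp add: norm_mult norm_power)
  then show ?thesis
    by (intro abs_convergent_prod_imp_convergent_prod summable_imp_abs_convergent_prod)
qed

lemma qpoch_LIMSEQ: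
  assumes "norm p < 1"
  shows "(\<lambda>N. \<Prod>n<N. 1 - a * p ^ n) \<longlonglongrightarrow> qpoch a p"
proof -
  have "(\<lambda>N. \<Prod>n\<le>N. 1 - a * p ^ n) \<longlonglongrightarrow> qpoch a p"
    unfolding qpoch_def using convergent_prod_LIMSEQ[OF convergent_prod_qpoch[OF assms]] .
  then have "(\<lambda>N. \<Prod>n<Suc N. 1 - a * p ^ n) \<longlonglongrightarrow> qpoch a p"
    by (simp only: lessThan_Suc_atMost)
  then show ?thesis
    by (rule LIMSEQ_imp_Suc)
qed

lemma qpoch_rec:
  assumes "norm p < 1"
  shows "qpoch a p = (1 - a) * qpoch (a * p) p"
proof -
  have "(\<lambda>N. \<Prod>n<Suc N. 1 - a * p ^ n) \<longlonglongrightarrow> qpoch a p"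
    using LIMSEQ_Suc[OF qpoch_LIMSEQ[OF assms]] .
  moreover have "(\<Prod>n<Suc N. 1 - a * p ^ n) = (1 - a) * (\<Prod>n<N. 1 - a * p * p ^ n)" for N
    by (subst prod.lessThan_Suc_shift) (simp add: mult.assoc)
  ultimately have "(\<lambda>N. (1 - a) * (\<Prod>n<N. 1 - a * p * p ^ n)) \<longlonglongrightarrow> qpoch a p"
    by simp
  moreover have "(\<lambda>N. (1 - a) * (\<Prod>n<N. 1 - a * p * p ^ n)) \<longlonglongrightarrow> (1 - a) * qpoch (a * p) p"
    by (intro tendsto_intros qpoch_LIMSEQ assms)
  ultimately show ?thesis
    by (rule LIMSEQ_unique)
qed

lemma qpoch_nonzero:
  assumes "norm p < 1" and "\<And>n. a * p ^ n \<noteq> 1"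
  shows "qpoch a p \<noteq> 0"
  unfolding qpoch_def
  by (intro prodinf_nonzero convergent_prod_qpoch assms(1)) (metis assms(2) right_minus_eq)

lemma qpoch_nonzero_if_norm_less_1:
  assumes "norm p < 1" and "norm a < 1"
  shows "qpoch a p \<noteq> 0"
proof (rule qpoch_nonzero[OF assms(1)])
  fix n
  have "norm (a * p ^ n) \<le> norm a * 1"
    unfolding norm_mult norm_power using assms by (intro mult_left_mono power_le_one) auto
  then show "a * p ^ n \<noteq> 1"
    using assms by auto
qed

text \<open>Factor by factor this is (1 - x)(1 + x) = 1 - x^2.\<close>

lemma qpoch_mult_minus:
  assumes "norm p < 1"
  shows "qpoch a p * qpoch (- a) p = qpoch (a\<^sup>2) (p\<^sup>2)"
proof -
  have "(\<Prod>n<N. 1 - a * p ^ n) * (\<Prod>n<N. 1 - (- a) * p ^ n) = (\<Prod>n<N. 1 - a\<^sup>2 * (p\<^sup>2) ^ n)" for N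
    unfolding prod.distrib[symmetric]
    by (intro prod.cong refl) (simp add: algebra_simps power2_eq_square power_mult_distrib)
  then have "(\<lambda>N. \<Prod>n<N. 1 - a\<^sup>2 * (p\<^sup>2) ^ n) \<longlonglongrightarrow> qpoch a p * qpoch (- a) p"
    using tendsto_mult[OF qpoch_LIMSEQ[OF assms] qpoch_LIMSEQ[OF assms], of a "- a"] by simp
  moreover have "norm (p\<^sup>2) < 1"
    using assms by (simp add: norm_power power_less_one_iff)
  ultimately show ?thesis
    using LIMSEQ_unique qpoch_LIMSEQ by blast
qed

text \<open>The factors are sorted by the residue of the exponent modulo \<open>k\<close>. The
  regrouping is done in the finite product of the first \<open>N * k\<close> factors; these cut-offs
  form a subsequence, so their limit is the whole product.\<close>

lemma qpoch_dissect:
  assumes "norm p < 1" and "k > 0"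
  shows "qpoch a p = (\<Prod>j<k. qpoch (a * p ^ j) (p ^ k))"
proof -
  have k: "norm (p ^ k) < 1"
    using assms by (simp add: norm_power power_less_one_iff)
  have "(\<Prod>n<N * k. 1 - a * p ^ n) = (\<Prod>j<k. \<Prod>n<N. 1 - a * p ^ j * (p ^ k) ^ n)" for N
  proof -
    have "(\<Prod>n<N * k. 1 - a * p ^ n) = (\<Prod>n<N. \<Prod>j\<in>{n * k..<n * k + k}. 1 - a * p ^ j)"
      using prod.nat_group[of "\<lambda>n. 1 - a * p ^ n" k N] by simp
    also have "\<dots> = (\<Prod>n<N. \<Prod>j<k. 1 - a * p ^ j * (p ^ k) ^ n)"
    proof (rule prod.cong[OF refl])
      fix n
      show "(\<Prod>j\<in>{n * k..<n * k + k}. 1 - a * p ^ j) = (\<Prod>j<k. 1 - a * p ^ j * (p ^ k) ^ n)"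
        using prod.shift_bounds_nat_ivl[of "\<lambda>j. 1 - a * p ^ j" 0 "n * k" k]
        by (simp add: power_add power_mult[symmetric] mult_ac add.commute atLeast0LessThan)
    qed
    also have "\<dots> = (\<Prod>j<k. \<Prod>n<N. 1 - a * p ^ j * (p ^ k) ^ n)"
      by (rule prod.swap)
    finally show ?thesis .
  qed
  moreover have "(\<lambda>N. \<Prod>n<N * k. 1 - a * p ^ n) \<longlonglongrightarrow> qpoch a p"
    by (rule filterlim_compose[OF qpoch_LIMSEQ[OF assms(1)]])
       (use assms(2) in \<open>auto intro!: filterlim_subseq strict_monoI\<close>)
  moreover have "(\<lambda>N. \<Prod>j<k. \<Prod>n<N. 1 - a * p ^ j * (p ^ k) ^ n)
      \<longlonglongrightarrow> (\<Prod>j<k. qpoch (a * p ^ j) (p ^ k))"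
    by (intro tendsto_prod qpoch_LIMSEQ k)
  ultimately show ?thesis
    using LIMSEQ_unique by simp
qed

text \<open>The partial products are polynomials in \<open>a\<close>. On a closed unit disc around
  any point the terms \<open>a * p ^ n\<close> are dominated by a geometric series, so convergence
  is locally uniform and the limit is entire; composition with \<open>f\<close> does the
  rest.\<close>

lemma holomorphic_on_qpoch [holomorphic_intros]:
  assumes "norm p < 1" and "f holomorphic_on S"
  shows "(\<lambda>z. qpoch (f z) p) holomorphic_on S"
proof -
  have "(\<lambda>a. qpoch a p) holomorphic_on UNIV"
  proof (rule holomorphic_uniform_sequence)
    show "(\<lambda>a. \<Prod>n<N. 1 - a * p ^ n) holomorphic_on UNIV" for N
      by (intro holomorphic_intros)
  next
    fix x :: complex
    have unif: "uniformly_convergent_on (cball x 1) (\<lambda>N a. \<Prod>n<N. 1 - a * p ^ n)"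
    proof (rule uniformly_convergent_on_prod')
      have "uniformly_convergent_on (cball x 1) (\<lambda>N a. \<Sum>n<N. norm (a * p ^ n))"
      proof (rule Weierstrass_m_test')
        fix n a assume "a \<in> cball x 1"
        then have "norm a \<le> norm x + 1"
          using norm_triangle_ineq2[of a x] by (simp add: dist_norm norm_minus_commute)
        then show "norm (norm (a * p ^ n)) \<le> (norm x + 1) * norm p ^ n"
          by (simp add: norm_mult norm_power mult_right_mono)
      next
        show "summable (\<lambda>n. (norm x + 1) * norm p ^ n)"
          using assms(1) by (intro summable_mult summable_geometric) auto
      qed
      then show "uniformly_convergent_on (cball x 1) (\<lambda>N a. \<Sum>n<N. norm ((1 - a * p ^ n) - 1))"
        by simp
    qed (auto intro!: continuous_intros)
    then obtain l where l: "uniform_limit (cball x 1) (\<lambda>N a. \<Prod>n<N. 1 - a * p ^ n) l sequentially"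
      by (auto simp: uniformly_convergent_on_def)
    have "l a = qpoch a p" if "a \<in> cball x 1" for a
      using LIMSEQ_unique[OF tendsto_uniform_limitI[OF l that] qpoch_LIMSEQ[OF assms(1)]] .
    with l have "uniform_limit (cball x 1) (\<lambda>N a. \<Prod>n<N. 1 - a * p ^ n) (\<lambda>a. qpoch a p) sequentially"
      by (auto simp: uniform_limit_iff)
    then show "\<exists>d>0. cball x d \<subseteq> UNIV \<and>
        uniform_limit (cball x d) (\<lambda>N a. \<Prod>n<N. 1 - a * p ^ n) (\<lambda>a. qpoch a p) sequentially"
      by (intro exI[of _ 1]) auto
  qed auto
  from holomorphic_on_compose_gen[OF assms(2) this] show ?thesis
    by (simp add: o_def)
qed

text \<open>The modified Jacobi theta function of nome \<open>p\<close>: the Jacobi triple product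
  without its factor (p; p).\<close>

definition theta :: "complex \<Rightarrow> complex \<Rightarrow> complex" where
  "theta z p = qpoch z p * qpoch (p / z) p"

lemma holomorphic_on_theta [holomorphic_intros]:
  assumes "norm p < 1" and "f holomorphic_on S" and "\<And>z. z \<in> S \<Longrightarrow> f z \<noteq> 0"
  shows "(\<lambda>z. theta (f z) p) holomorphic_on S"
  unfolding theta_def
  by (intro holomorphic_on_mult holomorphic_on_qpoch holomorphic_on_divide holomorphic_on_const assms)

lemma theta_one: "norm p < 1 \<Longrightarrow> theta 1 p = 0"
  using qpoch_rec[of p 1] by (simp add: theta_def)

text \<open>Passing from \<open>z\<close> to \<open>p * z\<close> removes the factor 1 - z from the
  first symbol and adds 1 - 1/z to the second; the net effect is the multiplier -1/z.\<close>

lemma theta_shift: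
  assumes "norm p < 1" and "z \<noteq> 0" and "p \<noteq> 0"
  shows "theta (p * z) p = - theta z p / z"
proof -
  have "theta (p * z) p = qpoch (z * p) p * ((1 - 1 / z) * qpoch (p / z) p)"
    using assms qpoch_rec[OF assms(1), of "1 / z"] by (simp add: theta_def mult.commute)
  also have "1 - 1 / z = - (1 - z) / z"
    using assms by (simp add: field_simps)
  also have "qpoch (z * p) p * (- (1 - z) / z * qpoch (p / z) p) = - theta z p / z"
    by (simp only: theta_def qpoch_rec[OF assms(1), of z]) (simp add: algebra_simps diff_divide_distrib)
  finally show ?thesis .
qed

lemma theta_reflect: "p \<noteq> 0 \<Longrightarrow> theta (p / z) p = theta z p"
  by (simp add: theta_def mult.commute)

text \<open>Inversion is the reflection applied to \<open>p * z\<close>, followed by one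
  shift.\<close>

lemma theta_inverse:
  assumes "norm p < 1" and "z \<noteq> 0" and "p \<noteq> 0"
  shows "theta (1 / z) p = - theta z p / z"
proof -
  have "theta (1 / z) p = theta (p / (p * z)) p"
    using assms by simp
  then show ?thesis
    using theta_shift[OF assms] theta_reflect[OF assms(3), of "p * z"] by simp
qed

lemma theta_unshift:
  assumes "norm p < 1" and "z \<noteq> 0" and "p \<noteq> 0"
  shows "theta (z / p) p = - (z / p) * theta z p"
proof -
  have "theta z p = - theta (z / p) p / (z / p)"
    using theta_shift[of p "z / p"] assms by simp
  then show ?thesis
    using assms by (metis divide_eq_0_iff minus_divide_left minus_mult_minus mult.commute nonzero_eq_divide_eq)
qed

section \<open>The two-variable theta identity\<close>

text \<open>The zeros are divided out one at a time. The linear factors already extracted do not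
  vanish at the new point \<open>a\<close>, so the cofactor \<open>g\<close> does, and
  \<open>g z / (z - a)\<close> has a removable singularity there, filled with the derivative of
  \<open>g\<close>.\<close>

lemma holomorphic_factor_zeros:
  assumes "finite A" and "open S" and "f holomorphic_on S" and "\<And>a. a \<in> A \<Longrightarrow> f a = 0"
    and "A \<subseteq> S"
  obtains g where "g holomorphic_on S" and "\<And>z. z \<in> S \<Longrightarrow> f z = (\<Prod>a\<in>A. z - a) * g z"
  using assms
proof (induction A arbitrary: thesis rule: finite_induct)
  case empty
  then show ?case by simp
next
  case (insert a A)
  obtain g where g: "g holomorphic_on S" "\<And>z. z \<in> S \<Longrightarrow> f z = (\<Prod>a\<in>A. z - a) * g z"
    using insert.IH insert.prems by blast
  have "(\<Prod>b\<in>A. a - b) \<noteq> 0"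
    using insert.hyps by auto
  then have "g a = 0"
    using g(2)[of a] insert.prems by auto
  define h where "h = (\<lambda>z. if z = a then deriv g a else g z / (z - a))"
  have "h holomorphic_on S"
    by (rule pole_theorem_open_0[OF g(1) \<open>open S\<close>, of a]) (use \<open>g a = 0\<close> in \<open>auto simp: h_def\<close>)
  moreover have "f z = (\<Prod>b\<in>insert a A. z - b) * h z" if "z \<in> S" for z
    using g(2)[OF that] insert.hyps \<open>g a = 0\<close> by (auto simp: h_def)
  ultimately show ?case
    using insert.prems(1) by blast
qed

section \<open>Quasi-periodicity and zeros of the two sides\<close>

definition theta_lhs :: "complex \<Rightarrow> complex \<Rightarrow> complex" where
  "theta_lhs w z = theta (w / z) (w ^ 3) * theta (w ^ 4 * z ^ 4) (w ^ 12)
     - z * theta (w * z) (w ^ 3) * theta (w ^ 4 / z ^ 4) (w ^ 12)"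

text \<open>Only the part of the right-hand side that depends on \<open>z\<close>; the two theta
  constants in front of it are recovered at the end as the value of \<open>c\<close>.\<close>

definition theta_rhs :: "complex \<Rightarrow> complex \<Rightarrow> complex" where
  "theta_rhs w z = theta z w * theta (w ^ 3 / z ^ 2) (w ^ 6)"

text \<open>Replacing \<open>z\<close> by \<open>w ^ 3 * z\<close> moves each of the four theta
  arguments by exactly one period of its own nome, up or down. The explicit factor \<open>z\<close>
  of the second term contributes another \<open>w ^ 3\<close>, which makes the multipliers of both
  terms agree.\<close>

lemma theta_lhs_shift:
  assumes w: "w \<noteq> 0" "norm w < 1" and z: "z \<noteq> 0"
  shows "theta_lhs w (w ^ 3 * z) = theta_lhs w z / (w ^ 6 * z ^ 5)"
proof -
  have nz: "w ^ 3 \<noteq> 0" "w ^ 12 \<noteq> 0" and n: "norm (w ^ 3) < 1" "norm (w ^ 12) < 1"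
    using w norm_power_less_one by auto
  have 1: "theta (w / (w ^ 3 * z)) (w ^ 3) = - (w / z / w ^ 3) * theta (w / z) (w ^ 3)"
    using theta_unshift[OF n(1) _ nz(1), of "w / z"] w z by (simp add: mult.commute)
  have "w ^ 4 * (w ^ 3 * z) ^ 4 = w ^ 12 * (w ^ 4 * z ^ 4)"
    by (simp add: power_mult_distrib flip: power_mult)
  then have 2: "theta (w ^ 4 * (w ^ 3 * z) ^ 4) (w ^ 12) = - theta (w ^ 4 * z ^ 4) (w ^ 12) / (w ^ 4 * z ^ 4)"
    using theta_shift[OF n(2) _ nz(2), of "w ^ 4 * z ^ 4"] w z by simp
  have "w * (w ^ 3 * z) = w ^ 3 * (w * z)"
    by simp
  then have 3: "theta (w * (w ^ 3 * z)) (w ^ 3) = - theta (w * z) (w ^ 3) / (w * z)"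
    using theta_shift[OF n(1) _ nz(1), of "w * z"] w z by (simp add: mult.left_commute)
  have "w ^ 4 / (w ^ 3 * z) ^ 4 = w ^ 4 / z ^ 4 / w ^ 12"
    by (simp add: power_mult_distrib mult.commute flip: power_mult)
  then have 4: "theta (w ^ 4 / (w ^ 3 * z) ^ 4) (w ^ 12) = - (w ^ 4 / z ^ 4 / w ^ 12) * theta (w ^ 4 / z ^ 4) (w ^ 12)"
    using theta_unshift[OF n(2) _ nz(2), of "w ^ 4 / z ^ 4"] w z by simp
  have "(- (w / z / w ^ 3) * A) * (- B / (w ^ 4 * z ^ 4))
      - w ^ 3 * z * (- C / (w * z)) * (- (w ^ 4 / z ^ 4 / w ^ 12) * D)
      = (A * B - z * C * D) / (w ^ 6 * z ^ 5)" for A B C D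
    using w z by (simp add: field_simps eval_nat_numeral)
  then show ?thesis
    unfolding theta_lhs_def 1 2 3 4 .
qed

text \<open>For nome \<open>w\<close> the shift is three periods, with multiplier -1/(w^3 z^3); the
  other argument moves down one period of nome \<open>w ^ 6\<close>, with multiplier -1/(w^3
  z^2).\<close>

lemma theta_rhs_shift:
  assumes w: "w \<noteq> 0" "norm w < 1" and z: "z \<noteq> 0"
  shows "theta_rhs w (w ^ 3 * z) = theta_rhs w z / (w ^ 6 * z ^ 5)"
proof -
  have nz: "w ^ 6 \<noteq> 0" and n: "norm (w ^ 6) < 1"
    using w norm_power_less_one by auto
  have "theta (w ^ 3 * z) w = theta (w * (w * (w * z))) w"
    by (simp add: eval_nat_numeral mult.assoc)
  also have "\<dots> = - (- (- theta z w / z) / (w * z)) / (w * (w * z))"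
    using theta_shift[OF w(2) _ w(1)] w z by simp
  finally have 1: "theta (w ^ 3 * z) w = - (- (- theta z w / z) / (w * z)) / (w * (w * z))" .
  have "w ^ 3 / (w ^ 3 * z)\<^sup>2 = w ^ 3 / z\<^sup>2 / w ^ 6"
    by (simp add: power_mult_distrib mult.commute flip: power_mult)
  then have 2: "theta (w ^ 3 / (w ^ 3 * z)\<^sup>2) (w ^ 6) = - (w ^ 3 / z\<^sup>2 / w ^ 6) * theta (w ^ 3 / z\<^sup>2) (w ^ 6)"
    using theta_unshift[OF n _ nz, of "w ^ 3 / z\<^sup>2"] w z by simp
  have "- (- (- A / z) / (w * z)) / (w * (w * z)) * (- (w ^ 3 / z\<^sup>2 / w ^ 6) * B)
      = A * B / (w ^ 6 * z ^ 5)" for A B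
    using w z by (simp add: field_simps eval_nat_numeral)
  then show ?thesis
    unfolding theta_rhs_def 1 2 .
qed

lemma theta_lhs_one: "theta_lhs w 1 = 0"
  by (simp add: theta_lhs_def)

lemma theta_lhs_w:
  assumes w: "w \<noteq> 0" "norm w < 1"
  shows "theta_lhs w w = 0"
  using assms by (simp add: theta_lhs_def theta_one norm_power_less_one)

text \<open>Both terms vanish separately: one contains a theta function of nome
  \<open>w ^ 12\<close> at \<open>w ^ 12\<close>, the other one of nome \<open>w ^ 3\<close> at
  \<open>w ^ 3\<close>, and both are one shift away from the zero at 1.\<close>

lemma theta_lhs_w2:
  assumes w: "w \<noteq> 0" "norm w < 1"
  shows "theta_lhs w (w ^ 2) = 0"
proof -
  have "theta (w ^ 4 * (w\<^sup>2) ^ 4) (w ^ 12) = 0"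
    using theta_shift[of "w ^ 12" 1] w norm_power_less_one[of w 12]
    by (simp add: theta_one flip: power_mult power_add)
  moreover have "theta (w * w\<^sup>2) (w ^ 3) = 0"
    using theta_shift[of "w ^ 3" 1] w norm_power_less_one[of w 3]
    by (simp add: theta_one eval_nat_numeral)
  ultimately show ?thesis
    by (simp add: theta_lhs_def)
qed

text \<open>Here w z = w^3 (w/z), so the two theta functions of nome \<open>w ^ 3\<close> differ by
  a shift. As z^4 = w^6, the other two arguments are w^12/w^2 and 1/w^2, both reducible to theta at
  \<open>w ^ 2\<close>. The terms then differ by the factor z^2/w^3 = 1 and cancel.\<close>

lemma theta_lhs_half_period:
  assumes w: "w \<noteq> 0" "norm w < 1" and z: "z\<^sup>2 = w ^ 3"
  shows "theta_lhs w z = 0"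
proof -
  have nz: "w ^ 3 \<noteq> 0" "w ^ 12 \<noteq> 0" and n: "norm (w ^ 3) < 1" "norm (w ^ 12) < 1"
    using w norm_power_less_one by auto
  have z0: "z \<noteq> 0"
    using w z by auto
  have z4: "z ^ 4 = w ^ 6"
    using z by (metis mult_2_right numeral_Bit0 power_mult power2_eq_square power_add numeral_3_eq_3)
  have "w * z = w ^ 3 * (w / z)"
    using z z0 by (simp add: field_simps power2_eq_square)
  then have 1: "theta (w * z) (w ^ 3) = - theta (w / z) (w ^ 3) / (w / z)"
    using theta_shift[OF n(1) _ nz(1), of "w / z"] w z0 by simp
  have "w ^ 4 * z ^ 4 = w ^ 12 / (w ^ 2)" and "w ^ 4 / z ^ 4 = 1 / w ^ 2"
    using w by (simp_all add: z4 field_simps flip: power_add)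
  then have 2: "theta (w ^ 4 * z ^ 4) (w ^ 12) = theta (w ^ 2) (w ^ 12)"
    and 3: "theta (w ^ 4 / z ^ 4) (w ^ 12) = - theta (w ^ 2) (w ^ 12) / w ^ 2"
    using theta_reflect[OF nz(2)] theta_inverse[OF n(2) _ nz(2), of "w ^ 2"] w by simp_all
  have "z * z = w ^ 3"
    using z by (simp add: power2_eq_square)
  then have "A * B - z * (- A / (w / z)) * (- B / w ^ 2) = 0" for A B
    using w z0 by (simp add: field_simps eval_nat_numeral)
  then show ?thesis
    unfolding theta_lhs_def 1 2 3 .
qed

text \<open>The open annulus spans four powers of |w| while a period spans three, so it overlaps its
  own translate by \<open>w ^ 3\<close>. It is still narrow enough to contain only the five zeros of
  the right-hand side.\<close>

lemma theta_lhs_eq_const_mult_theta_rhs: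
  assumes w: "w \<noteq> 0" "norm w < 1"
  obtains c where "\<And>z. norm w ^ 3 < norm z \<Longrightarrow> norm z < 1 / norm w \<Longrightarrow> theta_lhs w z = c * theta_rhs w z"
proof -
  define b where "b = norm w"
  have b: "0 < b" "b < 1"
    using w by (auto simp: b_def)
  define U where "U = {z::complex. b ^ 3 < norm z \<and> norm z < 1 / b}"
  have U0: "z \<noteq> 0" if "z \<in> U" for z
    using that b by (auto simp: U_def)
  have "open U"
    unfolding U_def by (intro open_Collect_conj open_Collect_less continuous_intros)
  have "connected U"
    using connected_annulus(1)[of "b ^ 3" "0::complex" "1 / b"] by (simp add: U_def)

  have inU: "z \<in> U" if "b ^ 2 \<le> norm z" "norm z \<le> 1" for z
  proof -
    have "b ^ 3 < b ^ 2"
      using b by (intro power_strict_decreasing) auto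
    moreover have "1 < 1 / b"
      using b by simp
    ultimately show ?thesis
      using that by (auto simp: U_def)
  qed
  \<comment> \<open>\<open>s\<close> and \<open>- s\<close> are the half-period points, the zeros of
    the factor of nome \<open>w ^ 6\<close>.\<close>
  define s where "s = csqrt (w ^ 3)"
  have s2: "s ^ 2 = w ^ 3"
    by (simp add: s_def)
  then have ns: "norm s ^ 2 = b ^ 3"
    by (metis b_def norm_power)
  have b32: "b ^ 3 < b ^ 2" "b ^ 4 < b ^ 3" "b ^ 2 < b"
    using b power_strict_decreasing[of 2 3 b] power_strict_decreasing[of 3 4 b]
      power_strict_decreasing[of 1 2 b] by auto
  have s_less: "norm s < b"
    using ns b32 b by (metis less_eq_real_def power2_less_imp_less)
  have s_greater: "b ^ 2 < norm s"
  proof (rule power2_less_imp_less)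
    show "(b ^ 2)\<^sup>2 < norm s ^ 2"
      using ns b32 by (simp flip: power_mult)
  qed auto
  define A where "A = {1, w, w ^ 2, s, - s}"
  have norms: "norm (w ^ 2) = b ^ 2" "norm w = b"
    by (simp_all add: b_def norm_power)
  have "A \<subseteq> U"
    using b b32 s_less s_greater norms by (auto simp: A_def intro!: inU)
  \<comment> \<open>The norms 1 > b > |s| > b^2 separate all pairs except \<open>s\<close> and
    \<open>- s\<close>.\<close>
  have dist: "1 \<noteq> w" "1 \<noteq> w ^ 2" "1 \<noteq> s" "1 \<noteq> - s" "w \<noteq> w ^ 2" "w \<noteq> s" "w \<noteq> - s"
    "w ^ 2 \<noteq> s" "w ^ 2 \<noteq> - s" "s \<noteq> - s"
    using b b32 s_less s_greater norms by (auto dest: arg_cong[of _ _ norm])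
  have prodA: "(\<Prod>a\<in>A. z - a) = (z - 1) * (z - w) * (z - w ^ 2) * (z ^ 2 - w ^ 3)" for z
  proof -
    have "(\<Prod>a\<in>A. z - a) = (z - 1) * (z - w) * (z - w ^ 2) * ((z - s) * (z + s))"
      using dist by (simp add: A_def mult.assoc)
    also have "(z - s) * (z + s) = z ^ 2 - w ^ 3"
      by (simp add: s2[symmetric] power2_eq_square algebra_simps)
    finally show ?thesis .
  qed
  have zeros: "theta_lhs w a = 0" if "a \<in> A" for a
    using that theta_lhs_one theta_lhs_w[OF w] theta_lhs_w2[OF w] theta_lhs_half_period[OF w] s2
    by (auto simp: A_def)
  have "theta_lhs w holomorphic_on U"
    unfolding theta_lhs_def using U0 w
    by (intro holomorphic_intros norm_power_less_one) auto
  then obtain g where g: "g holomorphic_on U"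
    "\<And>z. z \<in> U \<Longrightarrow> theta_lhs w z = (\<Prod>a\<in>A. z - a) * g z"
    using holomorphic_factor_zeros[of A U "theta_lhs w"] zeros \<open>A \<subseteq> U\<close> \<open>open U\<close>
    by (auto simp: A_def)

  \<comment> \<open>\<open>R\<close> is what remains of the right-hand side after splitting off 1 -
    z, 1 - w/z, 1 - w^2/z and 1 - w^3/z^2, the factors that vanish on \<open>A\<close>. On
    \<open>U\<close> the four remaining first arguments have norm below 1, so \<open>R\<close> has
    no zero there.\<close>
  define R where "R = (\<lambda>z. qpoch (z * w) w * qpoch (w ^ 3 / z) w *
    (qpoch (w ^ 9 / z ^ 2) (w ^ 6) * qpoch (w ^ 3 * z ^ 2) (w ^ 6)))"
  have rhs: "theta_rhs w z = - (\<Prod>a\<in>A. z - a) * R z / z ^ 4" if "z \<noteq> 0" for z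
  proof -
    have "qpoch (w / z) w = (1 - w / z) * ((1 - w / z * w) * qpoch (w / z * w * w) w)"
      by (metis qpoch_rec[OF w(2)])
    also have "w / z * w * w = w ^ 3 / z"
      by (simp add: eval_nat_numeral)
    finally have 1: "qpoch (w / z) w = (1 - w / z) * ((1 - w / z * w) * qpoch (w ^ 3 / z) w)" .
    have 2: "qpoch z w = (1 - z) * qpoch (z * w) w"
      by (rule qpoch_rec[OF w(2)])
    have "w ^ 3 / z\<^sup>2 * w ^ 6 = w ^ 9 / z\<^sup>2"
      by (simp flip: power_add)
    then have 3: "qpoch (w ^ 3 / z\<^sup>2) (w ^ 6) = (1 - w ^ 3 / z\<^sup>2) * qpoch (w ^ 9 / z\<^sup>2) (w ^ 6)"
      using qpoch_rec[of "w ^ 6" "w ^ 3 / z\<^sup>2"] norm_power_less_one[OF w(2), of 6] by simp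
    have 4: "w ^ 6 / (w ^ 3 / z\<^sup>2) = w ^ 3 * z\<^sup>2"
      using w that by (simp add: field_simps flip: power_add)
    have "(1 - z) * X * ((1 - w / z) * ((1 - w / z * w) * Y)) * ((1 - w ^ 3 / z\<^sup>2) * Z * Z')
        = - ((z - 1) * (z - w) * (z - w ^ 2) * (z ^ 2 - w ^ 3)) * (X * Y * (Z * Z')) / z ^ 4"
      for X Y Z Z'
    proof -
      define t where "t = 1 - z"
      have t: "1 - z = t" "z - 1 = - t"
        by (simp_all add: t_def)
      have e: "1 - w / z = (z - w) / z" "1 - w / z * w = (z - w ^ 2) / z"
        "1 - w ^ 3 / z\<^sup>2 = (z ^ 2 - w ^ 3) / z ^ 2"
        using that by (simp_all add: field_simps power2_eq_square)
      have "z ^ 4 = z * z * z ^ 2"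
        by (simp add: eval_nat_numeral)
      then show ?thesis
        unfolding e t using that by (simp add: mult_ac)
    qed
    then show ?thesis
      unfolding theta_rhs_def theta_def 1 2 3 4 prodA R_def .
  qed
  have RU: "R z \<noteq> 0" if "z \<in> U" for z
  proof -
    have z: "b ^ 3 < norm z" "norm z < 1 / b" "z \<noteq> 0"
      using that U0 by (auto simp: U_def)
    have zb: "norm z * b < 1"
      using z b by (simp add: field_simps)
    have "norm (w ^ 9 / z ^ 2) < 1"
    proof -
      have "(b ^ 3)\<^sup>2 < norm z ^ 2"
        using z b by (intro power_strict_mono) auto
      moreover have "b ^ 9 \<le> b ^ 6"
        using b by (intro power_decreasing) auto
      ultimately show ?thesis
        using z by (simp add: norm_divide norm_power norms flip: power_mult)
    qed
    moreover have "norm (w ^ 3 * z ^ 2) < 1"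
    proof -
      have "(norm z * b) ^ 2 < 1"
        using zb b by (intro power_less_one_iff[THEN iffD2]) auto
      then have "b * (norm z * b) ^ 2 < 1 * 1"
        using b by (intro mult_strict_mono) auto
      then show ?thesis
        by (simp add: norm_mult norm_power norms power_mult_distrib eval_nat_numeral mult_ac)
    qed
    moreover have "norm (z * w) < 1" "norm (w ^ 3 / z) < 1"
      using z zb by (simp_all add: norm_mult norm_divide norm_power norms)
    ultimately show ?thesis
      using w norm_power_less_one[OF w(2), of 6] by (simp add: R_def qpoch_nonzero_if_norm_less_1)
  qed
  \<comment> \<open>The quotient of the two sides with the product over \<open>A\<close> cancelled,
    hence also defined at the five zeros.\<close>
  define h where "h = (\<lambda>z. - (z ^ 4 * g z) / R z)"
  have "R holomorphic_on U"
    unfolding R_def using U0 w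
    by (intro holomorphic_intros norm_power_less_one) auto
  then have "h holomorphic_on U"
    unfolding h_def using RU by (intro holomorphic_intros g(1)) auto
  have lhs: "theta_lhs w z = h z * theta_rhs w z" if "z \<in> U" for z
    using that g(2) U0 RU rhs by (simp add: h_def)
  \<comment> \<open>For these \<open>z\<close> both \<open>z\<close> and \<open>w ^ 3 * z\<close>
    lie in \<open>U\<close>. The latter has norm between b^3 and b^2, below all points of
    \<open>A\<close>, so the right-hand side is nonzero there and can be cancelled.\<close>
  have shift: "w ^ 3 * z \<in> U" "z \<in> U" "h (w ^ 3 * z) = h z" if z: "1 < norm z" "norm z < 1 / b" for z
  proof -
    have z0: "z \<noteq> 0"
      using z by auto
    have n: "norm (w ^ 3 * z) = b ^ 3 * norm z"
      by (simp add: norm_mult norm_power norms)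
    have "b ^ 3 * norm z < b ^ 3 * (1 / b)"
      using z b by (intro mult_strict_left_mono) auto
    also have "b ^ 3 * (1 / b) = b ^ 2"
      using b by (simp add: eval_nat_numeral)
    finally have n2: "norm (w ^ 3 * z) < b ^ 2"
      using n by simp
    moreover have "b ^ 2 < 1 / b"
      using b b32 by (smt (verit) less_divide_eq_1_pos)
    moreover have "b ^ 3 < b ^ 3 * norm z"
      using z b by simp
    ultimately show U1: "w ^ 3 * z \<in> U"
      using n by (auto simp: U_def)
    have "b ^ 3 < 1"
      using b by (simp add: power_less_one_iff)
    then show U2: "z \<in> U"
      using z by (auto simp: U_def)
    have "w ^ 3 * z \<notin> A"
      using n2 norms b b32 s_greater by (auto simp: A_def)
    then have nz: "theta_rhs w (w ^ 3 * z) \<noteq> 0"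
      using rhs[of "w ^ 3 * z"] RU[OF U1] w z0 by (auto simp: A_def)
    have "h (w ^ 3 * z) * theta_rhs w (w ^ 3 * z) = h z * theta_rhs w (w ^ 3 * z)"
      using lhs[OF U1] lhs[OF U2] theta_lhs_shift[OF w z0] theta_rhs_shift[OF w z0] by auto
    with nz show "h (w ^ 3 * z) = h z"
      by simp
  qed

  txt \<open>The closed annulus \<open>K\<close> is exactly one period wide and lies inside \<open>U\<close>, so the maximum
    of \<open>|h|\<close> over \<open>K\<close> is its maximum over the open set \<open>U\<close>.\<close>
  define \<rho> where "\<rho> = (1 + 1 / b) / 2"
  have \<rho>: "1 < \<rho>" "\<rho> < 1 / b"
    using b by (simp_all add: \<rho>_def field_simps)
  define K where "K = {z::complex. b ^ 3 * \<rho> \<le> norm z \<and> norm z \<le> \<rho>}"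
  have "K \<subseteq> U"
  proof
    fix z assume "z \<in> K"
    moreover have "b ^ 3 < b ^ 3 * \<rho>"
      using b \<rho> by simp
    ultimately show "z \<in> U"
      using \<rho> by (auto simp: K_def U_def)
  qed
  have "K = cball 0 \<rho> - ball 0 (b ^ 3 * \<rho>)"
    by (auto simp: K_def)
  then have "compact K"
    by (simp add: compact_diff)
  moreover have "continuous_on K (\<lambda>z. norm (h z))"
    using \<open>h holomorphic_on U\<close> \<open>K \<subseteq> U\<close>
    by (intro continuous_intros) (meson continuous_on_subset holomorphic_on_imp_continuous_on)
  moreover have "b ^ 3 < 1"
    using b by (simp add: power_less_one_iff)
  then have "of_real \<rho> \<in> K"
    using \<rho> by (auto simp: K_def)
  ultimately obtain \<xi> where \<xi>: "\<xi> \<in> K" "\<And>z. z \<in> K \<Longrightarrow> norm (h z) \<le> norm (h \<xi>)"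
    using continuous_attains_sup[of K "\<lambda>z. norm (h z)"] by blast
  have max: "norm (h z) \<le> norm (h \<xi>)" if "z \<in> U" for z
  proof -
    \<comment> \<open>A point of \<open>U\<close> beyond the outer rim of \<open>K\<close> is
      brought into \<open>K\<close> by multiplication with \<open>w ^ 3\<close>, one inside the
      inner rim by division.\<close>
    consider "z \<in> K" | "norm z > \<rho>" | "norm z < b ^ 3 * \<rho>"
      by (force simp: K_def)
    then show ?thesis
    proof cases
      case 1
      then show ?thesis using \<xi> by simp
    next
      case 2
      have z: "1 < norm z" "norm z < 1 / b"
        using 2 \<rho> that by (auto simp: U_def)
      have "b ^ 3 * norm z < b ^ 3 * (1 / b)"
        using z b by (intro mult_strict_left_mono) auto
      also have "b ^ 3 * (1 / b) = b ^ 2"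
        using b by (simp add: eval_nat_numeral)
      finally have "w ^ 3 * z \<in> K"
        using 2 b b32 \<rho> by (auto simp: K_def norm_mult norm_power norms)
      then show ?thesis
        using shift(3)[OF z] \<xi>(2) by metis
    next
      case 3
      define y where "y = z / w ^ 3"
      have y: "w ^ 3 * y = z" "norm y = norm z / b ^ 3"
        using w by (simp_all add: y_def norm_divide norm_power norms)
      have "1 < norm y" "norm y < \<rho>"
        using 3 that b by (simp_all add: y U_def field_simps)
      moreover have "b ^ 3 * \<rho> < 1"
      proof -
        have "b ^ 3 * \<rho> < b ^ 3 * (1 / b)"
          using \<rho> b by (intro mult_strict_left_mono) auto
        also have "b ^ 3 * (1 / b) = b ^ 2"
          using b by (simp add: eval_nat_numeral)
        finally show ?thesis
          using b b32 by simp
      qed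
      ultimately have "y \<in> K"
        by (auto simp: K_def)
      then show ?thesis
        using shift(3)[of y] \<open>1 < norm y\<close> \<open>norm y < \<rho>\<close> \<rho> y \<xi>(2) by (metis order_less_trans)
    qed
  qed
  have "h constant_on U"
    using maximum_modulus_principle[OF \<open>h holomorphic_on U\<close> \<open>open U\<close> \<open>connected U\<close> \<open>open U\<close> _ _ max]
      \<xi>(1) \<open>K \<subseteq> U\<close> by auto
  then obtain c where "\<And>z. z \<in> U \<Longrightarrow> h z = c"
    by (auto simp: constant_on_def)
  then have "theta_lhs w z = c * theta_rhs w z" if "norm w ^ 3 < norm z" "norm z < 1 / norm w" for z
    using lhs[of z] that by (simp add: U_def b_def)
  then show thesis
    using that by blast
qed

section \<open>Evaluation of the constant\<close>

lemma qpoch_i_mult_i: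
  assumes "norm p < 1"
  shows "qpoch (\<i> * p) p * qpoch (- \<i> * p) p * qpoch (p\<^sup>2) (p\<^sup>2) = qpoch (p ^ 4) (p ^ 4)"
proof -
  have "qpoch (\<i> * p) p * qpoch (- \<i> * p) p = qpoch (- (p\<^sup>2)) (p\<^sup>2)"
    using qpoch_mult_minus[OF assms, of "\<i> * p"] by (simp add: power_mult_distrib)
  moreover have "qpoch (p\<^sup>2) (p\<^sup>2) * qpoch (- (p\<^sup>2)) (p\<^sup>2) = qpoch (p ^ 4) (p ^ 4)"
    using qpoch_mult_minus[OF norm_power_less_one[OF assms], of 2 "p\<^sup>2"] by (simp flip: power_mult)
  ultimately show ?thesis
    by (simp add: mult.commute)
qed

text \<open>Since p/\<i> = -\<i> p, splitting off the first factor of the symbol at \<i> or -\<i>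
  leaves the product computed in \<open>qpoch_i_mult_i\<close>.\<close>

lemma theta_i:
  assumes "norm p < 1"
  shows "theta \<i> p * qpoch (p\<^sup>2) (p\<^sup>2) = (1 - \<i>) * qpoch (p ^ 4) (p ^ 4)"
    and "theta (- \<i>) p * qpoch (p\<^sup>2) (p\<^sup>2) = (1 + \<i>) * qpoch (p ^ 4) (p ^ 4)"
  using qpoch_i_mult_i[OF assms] qpoch_rec[OF assms, of \<i>] qpoch_rec[OF assms, of "- \<i>"]
  by (simp_all add: theta_def divide_i mult_ac)

lemma theta_mult_minus:
  assumes "norm p < 1"
  shows "theta z p * theta (- z) p = theta (z\<^sup>2) (p\<^sup>2)"
  using qpoch_mult_minus[OF assms, of z] qpoch_mult_minus[OF assms, of "p / z"]
  by (simp add: theta_def power_divide mult_ac)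

lemma theta_nonzero:
  assumes "norm p < 1" "norm p < norm z" "norm z < 1"
  shows "theta z p \<noteq> 0"
proof -
  have "norm (p / z) < 1"
    using assms by (cases "z = 0") (auto simp: norm_divide)
  then show ?thesis
    using assms by (simp add: theta_def qpoch_nonzero_if_norm_less_1)
qed

theorem theta_two_variable_identity:
  assumes w: "w \<noteq> 0" "norm w < 1" and z: "norm w ^ 3 < norm z" "norm z < 1 / norm w"
  shows "theta_lhs w z = theta w (w ^ 6) * theta (w ^ 4) (w ^ 12) * theta_rhs w z"
proof -
  obtain c where c: "\<And>z. norm w ^ 3 < norm z \<Longrightarrow> norm z < 1 / norm w \<Longrightarrow>
      theta_lhs w z = c * theta_rhs w z"
    using theta_lhs_eq_const_mult_theta_rhs[OF w] by blast
  have n [simp]: "norm (w ^ k) < 1" if "k > 0" for k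
    using norm_power_less_one[OF w(2) that] .
  have pow: "norm w ^ k < norm w ^ l" if "l < k" for k l
    using that w by (intro power_strict_decreasing) auto
  \<comment> \<open>The evaluation point \<open>\<i> * w\<close> has norm |w|, strictly inside the
    annulus.\<close>
  have "norm w ^ 3 < norm (\<i> * w)"
    using pow[of 1 3] by (simp add: norm_mult)
  moreover have "norm (\<i> * w) < 1 / norm w"
    using w by (simp add: norm_mult) (smt (verit) less_divide_eq_1_pos zero_less_norm_iff)
  ultimately have "theta_lhs w (\<i> * w) = c * theta_rhs w (\<i> * w)"
    by (rule c)
  \<comment> \<open>Because \<i>^4 = 1, the second term contains theta at 1 and drops out.\<close>
  moreover have "theta_lhs w (\<i> * w) = theta (- \<i>) (w ^ 3) * theta (w ^ 4) (w ^ 12)"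
  proof -
    have "w ^ 4 * (\<i> * w) ^ 4 = w ^ 12 / w ^ 4"
      using w by (simp add: power_mult_distrib field_simps flip: power_add)
    moreover have "w / (\<i> * w) = - \<i>" "w ^ 4 / (\<i> * w) ^ 4 = 1"
      using w by (simp_all add: power_mult_distrib)
    ultimately show ?thesis
      using w by (simp add: theta_lhs_def theta_one theta_reflect)
  qed
  moreover have "theta_rhs w (\<i> * w) = \<i> * theta \<i> w * theta (- w) (w ^ 6)"
  proof -
    have "w ^ 3 / (\<i> * w) ^ 2 = - w"
      using w by (simp add: power_mult_distrib eval_nat_numeral)
    then show ?thesis
      using theta_shift[OF w(2) _ w(1), of \<i>] by (simp add: theta_rhs_def mult.commute divide_i)
  qed
  ultimately have eq: "theta (- \<i>) (w ^ 3) * theta (w ^ 4) (w ^ 12)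
      = c * (\<i> * theta \<i> w * theta (- w) (w ^ 6))"
    by simp
  have c1: "theta \<i> w * qpoch (w ^ 2) (w ^ 2) = (1 - \<i>) * qpoch (w ^ 4) (w ^ 4)"
    by (rule theta_i(1)[OF w(2)])
  have c2: "theta (- \<i>) (w ^ 3) * qpoch (w ^ 6) (w ^ 6) = (1 + \<i>) * qpoch (w ^ 12) (w ^ 12)"
    using theta_i(2)[OF n[of 3]] by (simp flip: power_mult)
  have c3: "theta w (w ^ 6) * theta (- w) (w ^ 6) = theta (w ^ 2) (w ^ 12)"
    using theta_mult_minus[OF n[of 6], of w] by (simp flip: power_mult)
  \<comment> \<open>All symbols are brought to the common base \<open>w ^ 12\<close>, where they can
    be cancelled against each other.\<close>
  have d2: "qpoch (w ^ 2) (w ^ 2) = qpoch (w ^ 2) (w ^ 12) * qpoch (w ^ 4) (w ^ 12)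
      * qpoch (w ^ 6) (w ^ 12) * qpoch (w ^ 8) (w ^ 12) * qpoch (w ^ 10) (w ^ 12) * qpoch (w ^ 12) (w ^ 12)"
    using qpoch_dissect[OF n[of 2], of 6 "w ^ 2"]
    by (simp add: eval_nat_numeral(2,3) lessThan_Suc mult_ac flip: power_mult power_add)
  have d4: "qpoch (w ^ 4) (w ^ 4) = qpoch (w ^ 4) (w ^ 12) * qpoch (w ^ 8) (w ^ 12) * qpoch (w ^ 12) (w ^ 12)"
    using qpoch_dissect[OF n[of 4], of 3 "w ^ 4"]
    by (simp add: eval_nat_numeral(2,3) lessThan_Suc mult_ac flip: power_mult power_add)
  have d6: "qpoch (w ^ 6) (w ^ 6) = qpoch (w ^ 6) (w ^ 12) * qpoch (w ^ 12) (w ^ 12)"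
    using qpoch_dissect[OF n[of 6], of 2 "w ^ 6"]
    by (simp add: eval_nat_numeral(2,3) lessThan_Suc mult_ac flip: power_mult power_add)
  have e2: "theta (w ^ 2) (w ^ 12) = qpoch (w ^ 2) (w ^ 12) * qpoch (w ^ 10) (w ^ 12)"
    using w by (simp add: theta_def flip: power_diff)
  define a where "a k = qpoch (w ^ k) (w ^ 12)" for k
  have a: "a k \<noteq> 0" if "k > 0" for k
    using that by (simp add: a_def qpoch_nonzero_if_norm_less_1)
  define X where "X = theta w (w ^ 6)"
  define Y where "Y = theta (- w) (w ^ 6)"
  define V where "V = theta (w ^ 4) (w ^ 12)"
  have "Y \<noteq> 0"
    unfolding Y_def using w pow[of 1 6] by (intro theta_nonzero) (auto simp: norm_power)
  have t1: "theta \<i> w * (a 2 * a 6 * a 10) = 1 - \<i>"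
    using c1 a[of 4] a[of 8] a[of 12] unfolding d2 d4 a_def[symmetric] by (auto simp: mult_ac)
  have t2: "theta (- \<i>) (w ^ 3) * a 6 = 1 + \<i>"
    using c2 a[of 12] unfolding d6 a_def[symmetric] by (auto simp: mult_ac)
  have XY: "X * Y = a 2 * a 10"
    using c3 by (simp add: X_def Y_def e2 a_def)
  \<comment> \<open>Multiplying by a 2, a 6 and a 10 clears both theta values at \<i> and -\<i>; the
    factor 1 + \<i> reappears on the right because \<i> (1 - \<i>) = 1 + \<i>.\<close>
  have "(1 + \<i>) * V * (a 2 * a 10) = theta (- \<i>) (w ^ 3) * V * (a 2 * a 6 * a 10)"
    by (simp add: t2[symmetric] mult_ac)
  also have "\<dots> = c * \<i> * Y * (theta \<i> w * (a 2 * a 6 * a 10))"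
    using eq by (simp add: V_def Y_def mult_ac)
  also have "\<dots> = (1 + \<i>) * (c * Y)"
    unfolding t1 by (simp add: algebra_simps)
  finally have "(1 + \<i>) * (X * V * Y) = (1 + \<i>) * (c * Y)"
    by (simp add: XY[symmetric] mult_ac)
  moreover have "1 + \<i> \<noteq> 0"
    by (simp add: complex_eq_iff)
  ultimately have "c = X * V"
    using \<open>Y \<noteq> 0\<close> by simp
  then show ?thesis
    using c[OF z] by (simp add: X_def V_def)
qed

section \<open>Generating functions of restricted partitions\<close>

abbreviation partitions :: "nat set \<Rightarrow> nat \<Rightarrow> nat multiset set" where
  "partitions S n \<equiv> {P. set_mset P \<subseteq> S \<and> sum_mset P = n}"

text \<open>Removing one part leaves a partition of a smaller number, since parts are positive; only
  finitely many parts can come first.\<close>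

lemma finite_partitions:
  assumes "0 \<notin> S"
  shows "finite (partitions S n)"
proof (induction n rule: less_induct)
  case (less n)
  have "partitions S n \<subseteq> {{#}} \<union> (\<Union>s\<in>{1..n}. add_mset s ` partitions S (n - s))"
  proof
    fix P assume P: "P \<in> partitions S n"
    show "P \<in> {{#}} \<union> (\<Union>s\<in>{1..n}. add_mset s ` partitions S (n - s))"
    proof (cases P)
      case (add s Q)
      then have "s \<in> {1..n}" "Q \<in> partitions S (n - s)"
        using P assms by (auto intro!: Suc_leI Nat.gr0I)
      then show ?thesis
        using add by blast
    qed simp
  qed
  moreover have "finite (partitions S (n - s))" if "s \<in> {1..n}" for s
    using that by (intro less.IH) auto
  ultimately show ?case
    by (elim finite_subset) auto
qed

lemma num_partitions_mono:
  assumes "0 \<notin> T" and "S \<subseteq> T"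
  shows "num_partitions S n \<le> num_partitions T n"
  unfolding num_partitions_def using assms by (intro card_mono finite_partitions) auto

lemma num_partitions_restrict:
  assumes "n \<le> k"
  shows "num_partitions (S \<inter> {..k}) n = num_partitions S n"
proof -
  have "x \<le> sum_mset P" if "x \<in># P" for x and P :: "nat multiset"
    using that by (metis sum_mset.remove le_add1)
  then have "partitions (S \<inter> {..k}) n = partitions S n"
    using assms by (fastforce intro: order_trans)
  then show ?thesis
    by (simp add: num_partitions_def)
qed

lemma num_partitions_empty: "num_partitions {} n = (if n = 0 then 1 else 0)"
proof -
  have "partitions {} n = (if n = 0 then {{#}} else {})"
    by auto
  then show ?thesis
    by (simp add: num_partitions_def)
qed

text \<open>A partition either avoids \<open>s\<close>, or it contains \<open>s\<close> and removing
  one copy gives an arbitrary partition of \<open>n - s\<close> over the same parts. This is the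
  coefficient form of multiplication by 1/(1 - q^s).\<close>

lemma num_partitions_insert:
  assumes "0 \<notin> S" and "s > 0" and "s \<notin> S"
  shows "num_partitions (insert s S) n =
    num_partitions S n + (if s \<le> n then num_partitions (insert s S) (n - s) else 0)"
proof -
  define B where "B = (if s \<le> n then add_mset s ` partitions (insert s S) (n - s) else {})"
  have "partitions (insert s S) n = partitions S n \<union> B"
  proof (intro equalityI subsetI)
    fix P assume P: "P \<in> partitions (insert s S) n"
    show "P \<in> partitions S n \<union> B"
    proof (cases "s \<in># P")
      case True
      then obtain Q where "P = add_mset s Q"
        by (metis insert_DiffM)
      then show ?thesis
        using P by (auto simp: B_def)
    qed (use P in auto)
  qed (auto simp: B_def split: if_splits)
  moreover have "s \<in># P" if "P \<in> B" for P
    using that by (auto simp: B_def split: if_splits)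
  then have "partitions S n \<inter> B = {}"
    using assms(3) by blast
  moreover have "finite (partitions S n)"
    by (rule finite_partitions[OF assms(1)])
  moreover have "finite B"
    using finite_partitions[of "insert s S" "n - s"] assms(1,2) by (simp add: B_def)
  ultimately have "num_partitions (insert s S) n = num_partitions S n + card B"
    by (simp add: num_partitions_def card_Un_disjoint)
  moreover have "card B = (if s \<le> n then num_partitions (insert s S) (n - s) else 0)"
    by (simp add: B_def num_partitions_def card_image inj_on_def)
  ultimately show ?thesis
    by simp
qed

section \<open>Convergence of the generating functions\<close>

lemma sums_shift_power:
  fixes f :: "nat \<Rightarrow> 'a :: real_normed_field"
  assumes "(\<lambda>n. f n * x ^ n) sums l"
  shows "(\<lambda>n. (if a \<le> n then f (n - a) else 0) * x ^ n) sums (x ^ a * l)"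
proof -
  define g where "g = (\<lambda>n. (if a \<le> n then f (n - a) else 0) * x ^ n)"
  have "(\<lambda>n. g (n + a)) sums (x ^ a * l)"
    using sums_mult[OF assms, of "x ^ a"] by (simp add: g_def power_add mult_ac)
  moreover have "(\<Sum>i<a. g i) = 0"
    by (simp add: g_def)
  ultimately have "g sums (x ^ a * l)"
    using sums_iff_shift[of g a] by simp
  then show ?thesis
    by (simp add: g_def)
qed

text \<open>By the recurrence for one new part \<open>s\<close>, partial sums satisfy F_N <= G + r^s
  F_N, where G is the sum for the old parts. This bounds F_N by G/(1 - r^s).\<close>

lemma summable_num_partitions_finite:
  fixes r :: real
  assumes "finite S" and "0 \<notin> S" and r: "0 \<le> r" "r < 1"
  shows "summable (\<lambda>n. num_partitions S n * r ^ n)"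
  using assms(1,2)
proof (induction S rule: finite_induct)
  case empty
  have "(\<lambda>n. real (num_partitions {} n) * r ^ n) = (\<lambda>n. if n = 0 then 1 else 0)"
    by (auto simp: num_partitions_empty)
  then show ?case
    by (simp add: summable_single[where f = "\<lambda>_. 1"])
next
  case (insert s S)
  define f where "f = (\<lambda>n. num_partitions (insert s S) n * r ^ n)"
  define g where "g = (\<lambda>n. num_partitions S n * r ^ n)"
  have f0: "f n \<ge> 0" and g0: "g n \<ge> 0" for n
    using r by (auto simp: f_def g_def)
  have g: "summable g"
    unfolding g_def using insert by simp
  have rs: "r ^ s < 1"
    using r insert.prems by (simp add: power_less_one_iff)
  have bound: "(\<Sum>n<N. f n) \<le> suminf g / (1 - r ^ s)" for N
  proof -
    have "f n = g n + (if s \<le> n then r ^ s * f (n - s) else 0)" for n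
      using num_partitions_insert[of S s n] insert.prems insert.hyps
      by (auto simp: f_def g_def algebra_simps simp flip: power_add)
    then have "(\<Sum>n<N. f n) = (\<Sum>n<N. g n) + (\<Sum>n<N. if s \<le> n then r ^ s * f (n - s) else 0)"
      by (simp add: sum.distrib)
    also have "(\<Sum>n<N. if s \<le> n then r ^ s * f (n - s) else 0) = (\<Sum>n\<in>{s..<N}. r ^ s * f (n - s))"
      by (rule sum.mono_neutral_cong_right) auto
    also have "\<dots> = (\<Sum>n<N - s. r ^ s * f n)"
      by (rule sum.reindex_bij_witness[of _ "\<lambda>n. n + s" "\<lambda>n. n - s"]) auto
    also have "\<dots> \<le> r ^ s * (\<Sum>n<N. f n)"
      unfolding sum_distrib_left[symmetric] using f0 r
      by (intro mult_left_mono sum_mono2) auto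
    also have "(\<Sum>n<N. g n) \<le> suminf g"
      using g g0 by (intro sum_le_suminf) auto
    finally have "(\<Sum>n<N. f n) * (1 - r ^ s) \<le> suminf g"
      by (simp add: algebra_simps)
    then show ?thesis
      using rs by (simp add: pos_le_divide_eq)
  qed
  have "summable f"
  proof (rule bounded_imp_summable[OF f0])
    show "(\<Sum>n\<le>N. f n) \<le> suminf g / (1 - r ^ s)" for N
      using bound[of "Suc N"] by (simp only: lessThan_Suc_atMost)
  qed
  then show ?case
    by (simp add: f_def)
qed

text \<open>Summing the recurrence gives F = G + q^s F, which can be solved for F. The field is left
  general because the result serves over the reals for bounds and over the complex numbers for
  identities.\<close>

lemma partitions_gf_finite:
  fixes q :: "'a :: {real_normed_field, banach}"
  assumes "finite S" and "0 \<notin> S" and q: "norm q < 1"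
  shows "(\<lambda>n. of_nat (num_partitions S n) * q ^ n) sums inverse (\<Prod>s\<in>S. 1 - q ^ s)"
  using assms(1,2)
proof (induction S rule: finite_induct)
  case empty
  have "(\<lambda>n. of_nat (num_partitions {} n) * q ^ n) = (\<lambda>n. if n = 0 then 1 else 0)"
    by (auto simp: num_partitions_empty)
  then show ?case
    using sums_single[of 0 "\<lambda>_. 1 :: 'a"] by simp
next
  case (insert s S)
  define F where "F = (\<lambda>n. of_nat (num_partitions (insert s S) n) * q ^ n)"
  have "summable (\<lambda>n. norm (F n))"
    using summable_num_partitions_finite[of "insert s S" "norm q"] insert q
    by (simp add: F_def norm_mult norm_power)
  then have F: "F sums suminf F"
    by (rule summable_sums[OF summable_norm_cancel])
  have "(\<lambda>n. of_nat (num_partitions S n) * q ^ n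
      + (if s \<le> n then of_nat (num_partitions (insert s S) (n - s)) else 0) * q ^ n)
      sums (inverse (\<Prod>s\<in>S. 1 - q ^ s) + q ^ s * suminf F)"
    using insert F unfolding F_def by (intro sums_add sums_shift_power) auto
  moreover have "of_nat (num_partitions S n) * q ^ n
      + (if s \<le> n then of_nat (num_partitions (insert s S) (n - s)) else 0) * q ^ n = F n" for n
    using num_partitions_insert[of S s n] insert by (auto simp: F_def algebra_simps)
  ultimately have "F sums (inverse (\<Prod>s\<in>S. 1 - q ^ s) + q ^ s * suminf F)"
    by simp
  with F have eq: "suminf F = inverse (\<Prod>s\<in>S. 1 - q ^ s) + q ^ s * suminf F"
    using sums_unique2 by blast
  have "norm (q ^ s) < 1"
    using q insert.prems by (simp add: norm_power power_less_one_iff)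
  then have "1 - q ^ s \<noteq> 0"
    by auto
  moreover have "suminf F * (1 - q ^ s) = inverse (\<Prod>s\<in>S. 1 - q ^ s)"
    using eq by (simp add: algebra_simps)
  ultimately have "suminf F = inverse (\<Prod>s\<in>S. 1 - q ^ s) / (1 - q ^ s)"
    by (simp add: nonzero_eq_divide_eq)
  then have "suminf F = inverse (\<Prod>s\<in>insert s S. 1 - q ^ s)"
    using insert.hyps by (simp add: divide_inverse mult.commute)
  then show ?case
    using F by (simp add: F_def)
qed

text \<open>The partial sum up to \<open>N\<close> involves only parts up to \<open>N\<close>, so it
  is at most the inverse product over all of \<open>{1..N}\<close>. These inverse products converge
  to the inverse of (r; r) and are therefore bounded.\<close>

lemma summable_num_partitions:
  fixes r :: real
  assumes "0 \<notin> S" and r: "0 \<le> r" "r < 1"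
  shows "summable (\<lambda>n. num_partitions S n * r ^ n)"
proof -
  \<comment> \<open>The real products are regarded as complex ones so that the limit for
    \<open>qpoch\<close> applies.\<close>
  have r': "norm (complex_of_real r) < 1"
    using r by simp
  have "(\<lambda>N. inverse (\<Prod>n<N. 1 - complex_of_real r * complex_of_real r ^ n))
      \<longlonglongrightarrow> inverse (qpoch r r)"
    using r' by (intro tendsto_inverse qpoch_LIMSEQ qpoch_nonzero_if_norm_less_1)
  then have "Bseq (\<lambda>N. inverse (\<Prod>n<N. 1 - complex_of_real r * complex_of_real r ^ n))"
    by (intro convergent_imp_Bseq convergentI)
  then obtain C where C: "\<And>N. norm (inverse (\<Prod>n<N. 1 - complex_of_real r * complex_of_real r ^ n)) \<le> C"
    by (auto simp: Bseq_def)
  have pos: "0 < 1 - r ^ s" if "s > 0" for s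
    using r that by (simp add: power_less_one_iff)
  have bound: "inverse (\<Prod>s\<in>{1..N}. 1 - r ^ s) \<le> C" for N
  proof -
    have "(\<Prod>n<N. 1 - complex_of_real r * complex_of_real r ^ n) = of_real (\<Prod>s\<in>{1..N}. 1 - r ^ s)"
      unfolding of_real_prod
      by (rule prod.reindex_bij_witness[of _ "\<lambda>s. s - 1" Suc]) auto
    moreover have "(\<Prod>s\<in>{1..N}. 1 - r ^ s) > 0"
      using pos by (intro prod_pos) auto
    ultimately show ?thesis
      using C[of N] by (simp only: norm_inverse norm_of_real abs_of_pos)
  qed
  have "(\<Sum>n\<le>N. num_partitions S n * r ^ n) \<le> C" for N
  proof -
    define T where "T = S \<inter> {..N}"
    have T: "finite T" "0 \<notin> T" "T \<subseteq> {1..N}"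
      using assms by (auto simp: T_def Suc_le_eq intro: Nat.gr0I)
    have gf: "(\<lambda>n. num_partitions T n * r ^ n) sums inverse (\<Prod>s\<in>T. 1 - r ^ s)"
      using partitions_gf_finite[OF T(1,2), of r] r by simp
    have "(\<Sum>n\<le>N. num_partitions S n * r ^ n) = (\<Sum>n\<le>N. num_partitions T n * r ^ n)"
      by (intro sum.cong refl) (simp add: T_def num_partitions_restrict)
    also have "\<dots> \<le> inverse (\<Prod>s\<in>T. 1 - r ^ s)"
      unfolding sums_unique[OF gf]
      using gf r by (intro sum_le_suminf) (auto simp: sums_iff)
    also have "\<dots> \<le> inverse (\<Prod>s\<in>{1..N}. 1 - r ^ s)"
    proof -
      \<comment> \<open>Enlarging the set of parts multiplies the product by factors between 0 and
        1.\<close>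
      have "(\<Prod>s\<in>{1..N}. 1 - r ^ s) \<le> (\<Prod>s\<in>T. 1 - r ^ s)"
      proof -
        have "(\<Prod>s\<in>{1..N}. 1 - r ^ s) = (\<Prod>s\<in>{1..N} - T. 1 - r ^ s) * (\<Prod>s\<in>T. 1 - r ^ s)"
          using T by (intro prod.subset_diff) auto
        also have "\<dots> \<le> 1 * (\<Prod>s\<in>T. 1 - r ^ s)"
        proof (rule mult_right_mono)
          show "(\<Prod>s\<in>{1..N} - T. 1 - r ^ s) \<le> 1"
          proof (rule prod_le_1)
            show "0 \<le> 1 - r ^ s \<and> 1 - r ^ s \<le> 1" if "s \<in> {1..N} - T" for s
              using pos[of s] that r by simp
          qed
          show "0 \<le> (\<Prod>s\<in>T. 1 - r ^ s)"
          proof (rule prod_nonneg)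
            show "0 \<le> 1 - r ^ s" if "s \<in> T" for s
              using pos[of s] that T by (cases "s = 0") auto
          qed
        qed
        finally show ?thesis by simp
      qed
      moreover have "(\<Prod>s\<in>{1..N}. 1 - r ^ s) > 0"
        using pos by (intro prod_pos) auto
      ultimately show ?thesis
        by (intro le_imp_inverse_le)
    qed
    also have "\<dots> \<le> C"
      by (rule bound)
    finally show ?thesis .
  qed
  then show ?thesis
    using r by (intro bounded_imp_summable) auto
qed

text \<open>Tannery's theorem: the coefficient at \<open>n\<close> is constant once \<open>k\<close>
  reaches \<open>n\<close>, and the convergent series at |q| dominates all truncations.\<close>

lemma partitions_gf_LIMSEQ:
  fixes q :: complex
  assumes "0 \<notin> S" and q: "norm q < 1"
  shows "summable (\<lambda>n. of_nat (num_partitions S n) * q ^ n)"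
    and "(\<lambda>k. inverse (\<Prod>s\<in>S \<inter> {..k}. 1 - q ^ s)) \<longlonglongrightarrow> (\<Sum>n. of_nat (num_partitions S n) * q ^ n)"
proof -
  have sum: "summable (\<lambda>n. num_partitions S n * norm q ^ n)"
    using assms by (intro summable_num_partitions) auto
  show "summable (\<lambda>n. of_nat (num_partitions S n) * q ^ n)"
  proof (rule summable_norm_cancel)
    show "summable (\<lambda>n. norm (of_nat (num_partitions S n) * q ^ n))"
      using sum by (simp add: norm_mult norm_power)
  qed
  have "(\<lambda>k. of_nat (num_partitions (S \<inter> {..k}) n) * q ^ n) \<longlonglongrightarrow> of_nat (num_partitions S n) * q ^ n"
    for n
  proof (rule tendsto_eventually)
    show "\<forall>\<^sub>F k in sequentially.
        of_nat (num_partitions (S \<inter> {..k}) n) * q ^ n = of_nat (num_partitions S n) * q ^ n"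
      using eventually_ge_at_top[of n] by eventually_elim (simp add: num_partitions_restrict)
  qed
  moreover have "norm (of_nat (num_partitions (S \<inter> {..k}) n) * q ^ n) \<le> num_partitions S n * norm q ^ n" for k n
    using num_partitions_mono[OF assms(1), of "S \<inter> {..k}" n]
    by (simp add: norm_mult norm_power mult_right_mono)
  then have "\<forall>\<^sub>F (n, k) in at_top \<times>\<^sub>F sequentially.
      norm (of_nat (num_partitions (S \<inter> {..k}) n) * q ^ n) \<le> num_partitions S n * norm q ^ n"
    by (intro always_eventually) auto
  ultimately have "(\<lambda>k. \<Sum>n. of_nat (num_partitions (S \<inter> {..k}) n) * q ^ n)
      \<longlonglongrightarrow> (\<Sum>n. of_nat (num_partitions S n) * q ^ n)"
    using tannerys_theorem[OF _ _ sum, of "\<lambda>n k. of_nat (num_partitions (S \<inter> {..k}) n) * q ^ n"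
        "\<lambda>n. of_nat (num_partitions S n) * q ^ n" sequentially] by simp
  moreover have "(\<Sum>n. of_nat (num_partitions (S \<inter> {..k}) n) * q ^ n) = inverse (\<Prod>s\<in>S \<inter> {..k}. 1 - q ^ s)" for k
    using partitions_gf_finite[of "S \<inter> {..k}" q] assms by (simp add: sums_iff)
  ultimately show "(\<lambda>k. inverse (\<Prod>s\<in>S \<inter> {..k}. 1 - q ^ s)) \<longlonglongrightarrow> (\<Sum>n. of_nat (num_partitions S n) * q ^ n)"
    by simp
qed

text \<open>Division with remainder writes each part as r + M n with r in \<open>X\<close>. The
  cut-offs \<open>M * k\<close> turn the set of parts into a full rectangle of pairs (r, n), whose
  product splits over \<open>X\<close>.\<close>

lemma partitions_gf_residues:
  fixes q :: complex
  assumes X: "X \<subseteq> {1..<M}" and q: "norm q < 1"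
  shows "(\<lambda>n. of_nat (num_partitions {n. n mod M \<in> X} n) * q ^ n) sums
    inverse (\<Prod>r\<in>X. qpoch (q ^ r) (q ^ M))"
proof (cases "X = {}")
  case True
  then show ?thesis
    using partitions_gf_finite[of "{}" q] q by simp
next
  case False
  then have M: "M > 0"
    using X by auto
  have fin: "finite X"
    using X finite_subset by blast
  define S where "S = {n. n mod M \<in> X}"
  have "0 \<notin> S"
    using X by (auto simp: S_def)
  have qM: "norm (q ^ M) < 1"
    using q M by (simp add: norm_power power_less_one_iff)
  have "(\<Prod>s\<in>S \<inter> {..M * k}. 1 - q ^ s) = (\<Prod>r\<in>X. \<Prod>n<k. 1 - q ^ r * (q ^ M) ^ n)" for k
  proof -
    have "(\<Prod>s\<in>S \<inter> {..M * k}. 1 - q ^ s) = (\<Prod>(r, n)\<in>X \<times> {..<k}. 1 - q ^ r * (q ^ M) ^ n)"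
    proof (rule prod.reindex_bij_witness[of _ "\<lambda>(r, n). r + M * n" "\<lambda>s. (s mod M, s div M)"])
      fix s assume s: "s \<in> S \<inter> {..M * k}"
      \<comment> \<open>The cut-off \<open>M * k\<close> itself has residue 0, which is not in
        \<open>X\<close>; hence the quotient stays strictly below \<open>k\<close>.\<close>
      then have "s \<noteq> M * k"
        using \<open>0 \<notin> S\<close> by (auto simp: S_def)
      then have "s < M * k"
        using s by auto
      then have "s div M < k"
        by (simp add: less_mult_imp_div_less mult.commute)
      then show "(s mod M, s div M) \<in> X \<times> {..<k}"
        using s by (auto simp: S_def)
      show "(case (s mod M, s div M) of (r, n) \<Rightarrow> 1 - q ^ r * (q ^ M) ^ n) = 1 - q ^ s"
        by (simp flip: power_mult power_add)
    next
      fix x assume "x \<in> X \<times> {..<k}"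
      then obtain r n where x: "x = (r, n)" "r \<in> X" "n < k"
        by auto
      then have r: "r < M"
        using X by auto
      have "r + M * n \<le> M * Suc n"
        using r by simp
      also have "\<dots> \<le> M * k"
        using x by (intro mult_left_mono) auto
      finally show "(case x of (r, n) \<Rightarrow> r + M * n) \<in> S \<inter> {..M * k}"
        using x r by (simp add: S_def)
      show "((case x of (r, n) \<Rightarrow> r + M * n) mod M, (case x of (r, n) \<Rightarrow> r + M * n) div M) = x"
        using x r by simp
    qed auto
    also have "\<dots> = (\<Prod>r\<in>X. \<Prod>n<k. 1 - q ^ r * (q ^ M) ^ n)"
      by (simp add: prod.cartesian_product)
    finally show ?thesis .
  qed
  moreover have "(\<lambda>k. inverse (\<Prod>r\<in>X. \<Prod>n<k. 1 - q ^ r * (q ^ M) ^ n))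
      \<longlonglongrightarrow> inverse (\<Prod>r\<in>X. qpoch (q ^ r) (q ^ M))"
  proof (intro tendsto_inverse tendsto_prod qpoch_LIMSEQ qM)
    have "qpoch (q ^ r) (q ^ M) \<noteq> 0" if "r \<in> X" for r
      using that X q by (intro qpoch_nonzero_if_norm_less_1 qM) (auto simp: norm_power power_less_one_iff)
    then show "(\<Prod>r\<in>X. qpoch (q ^ r) (q ^ M)) \<noteq> 0"
      using fin by simp
  qed
  moreover have "(\<lambda>k. inverse (\<Prod>s\<in>S \<inter> {..M * k}. 1 - q ^ s))
      \<longlonglongrightarrow> (\<Sum>n. of_nat (num_partitions S n) * q ^ n)"
    by (rule filterlim_compose[OF partitions_gf_LIMSEQ(2)[OF \<open>0 \<notin> S\<close> q]])
       (use M in \<open>auto intro!: filterlim_subseq strict_monoI\<close>)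
  ultimately have "(\<Sum>n. of_nat (num_partitions S n) * q ^ n) = inverse (\<Prod>r\<in>X. qpoch (q ^ r) (q ^ M))"
    using LIMSEQ_unique by simp
  then show ?thesis
    using partitions_gf_LIMSEQ(1)[OF \<open>0 \<notin> S\<close> q] by (simp add: S_def sums_iff)
qed

text \<open>A power series with zero constant term and some nonzero coefficient has an isolated zero
  at 0, which the zero function contradicts. The constant term is settled first, by evaluation at
  0.\<close>

lemma sums_zero_imp_coeff_zero:
  fixes a :: "nat \<Rightarrow> complex"
  assumes "\<And>q. norm q < 1 \<Longrightarrow> (\<lambda>n. a n * q ^ n) sums 0"
  shows "a n = 0"
proof (rule ccontr)
  assume n: "a n \<noteq> 0"
  have "a 0 = 0"
    using assms[of 0] powser_sums_zero_iff[of a 0] by simp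
  with n have "n > 0"
    by (auto intro: Nat.gr0I)
  show False
  proof (rule powser_0_nonzero[of 1 0 a "\<lambda>_. 0" n])
    show "(\<lambda>n. a n * (x - 0) ^ n) sums 0" if "norm (x - 0) < 1" for x
      using assms that by simp
    show False if "s > 0" and "\<And>z::complex. z \<in> cball 0 s - {0} \<Longrightarrow> (0::complex) \<noteq> 0" for s :: real
      using that(2)[of "of_real s"] that(1) by simp
  qed (use n \<open>n > 0\<close> in simp_all)
qed

text \<open>Coefficients are compared in F_X - q^a F_Y - 1, which vanishes on the unit disc; the
  constant 1 affects only index 0, and n >= a > 0.\<close>

lemma num_partitions_shift:
  assumes X: "X \<subseteq> {1..<M}" "Y \<subseteq> {1..<M}" and "a > 0"
    and eq: "\<And>q::complex. q \<noteq> 0 \<Longrightarrow> norm q < 1 \<Longrightarrow>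
      inverse (\<Prod>r\<in>X. qpoch (q ^ r) (q ^ M)) - q ^ a * inverse (\<Prod>r\<in>Y. qpoch (q ^ r) (q ^ M)) = 1"
    and "n \<ge> a"
  shows "num_partitions {n. n mod M \<in> X} n = num_partitions {n. n mod M \<in> Y} (n - a)"
proof -
  define f where "f = (\<lambda>n. complex_of_nat (num_partitions {n. n mod M \<in> X} n))"
  define g where "g = (\<lambda>n. complex_of_nat (num_partitions {n. n mod M \<in> Y} n))"
  define d where "d = (\<lambda>n. f n - (if a \<le> n then g (n - a) else 0) - (if n = 0 then 1 else 0))"
  have "(\<lambda>n. d n * q ^ n) sums 0" if q: "norm q < 1" for q
  proof -
    have eq': "inverse (\<Prod>r\<in>X. qpoch (q ^ r) (q ^ M)) - q ^ a * inverse (\<Prod>r\<in>Y. qpoch (q ^ r) (q ^ M)) = 1"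
    \<comment> \<open>The hypothesis excludes q = 0. There every symbol equals 1, because the
      residues are positive, and \<open>q ^ a\<close> vanishes.\<close>
    proof (cases "q = 0")
      case True
      have "qpoch (q ^ r) (q ^ M) = 1" if "r \<in> X" for r
        using that X True by (force simp: qpoch_def power_0_left)
      then show ?thesis
        using True \<open>a > 0\<close> by simp
    qed (use eq q in blast)
    have "(\<lambda>n. (if n = 0 then 1 else 0) * q ^ n) sums 1"
      using sums_single[of 0 "\<lambda>_. 1 :: complex"] by (rule sums_cong[THEN iffD1, rotated]) auto
    then have "(\<lambda>n. f n * q ^ n - (if a \<le> n then g (n - a) else 0) * q ^ n - (if n = 0 then 1 else 0) * q ^ n)
        sums (inverse (\<Prod>r\<in>X. qpoch (q ^ r) (q ^ M)) - q ^ a * inverse (\<Prod>r\<in>Y. qpoch (q ^ r) (q ^ M)) - 1)"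
      unfolding f_def g_def
      using q X by (intro sums_diff sums_shift_power partitions_gf_residues) auto
    then show ?thesis
      unfolding eq' by (simp add: d_def left_diff_distrib)
  qed
  then have "d n = 0"
    by (rule sums_zero_imp_coeff_zero)
  then show ?thesis
    using assms by (simp add: d_def f_def g_def)
qed

section \<open>Specialisation to modulus 60\<close>

text \<open>For r from 1 to 59 the classes of r and -r have the representatives r and 60 - r;
  neither is 0, which rules out n = 0.\<close>

lemma pm_residues_60_eq:
  assumes "R \<subseteq> {1..59}" and "X = nat ` R \<union> nat ` (\<lambda>r. 60 - r) ` R"
  shows "pm_residues R 60 = {n. n mod 60 \<in> X}"
proof (rule set_eqI)
  fix n
  have *: "(n > 0 \<and> ([int n = r] (mod 60) \<or> [int n = - r] (mod 60)))
      \<longleftrightarrow> n mod 60 = nat r \<or> n mod 60 = nat (60 - r)" if "r \<in> R" for r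
  proof -
    have r: "1 \<le> r" "r \<le> 59"
      using that assms(1) by auto
    have "(- r) mod 60 = 60 - r"
      using r by (simp add: zmod_zminus1_eq_if)
    moreover have "r mod 60 = r"
      using r by simp
    moreover have "int n mod 60 = int (n mod 60)"
      by (simp add: zmod_int)
    ultimately show ?thesis
      using r by (auto simp: unique_euclidean_semiring_class.cong_def intro: Nat.gr0I)
  qed
  have "n \<in> pm_residues R 60 \<longleftrightarrow>
      (\<exists>r\<in>R. n > 0 \<and> ([int n = r] (mod 60) \<or> [int n = - r] (mod 60)))"
    by (simp add: pm_residues_def)
  also have "\<dots> \<longleftrightarrow> (\<exists>r\<in>R. n mod 60 = nat r \<or> n mod 60 = nat (60 - r))"
    using * by (intro bex_cong refl)
  also have "\<dots> \<longleftrightarrow> n mod 60 \<in> X"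
    unfolding assms(2) by (simp only: bex_disj_distrib Un_iff image_iff bex_simps)
  finally show "n \<in> pm_residues R 60 \<longleftrightarrow> n \<in> {n. n mod 60 \<in> X}"
    by simp
qed

lemma qpoch_power_dissect_60:
  assumes "norm q < 1" and "m * k = 60"
  shows "qpoch (q ^ a) (q ^ m) = (\<Prod>j<k. qpoch (q ^ (a + m * j)) (q ^ 60))"
proof -
  have "m > 0" "k > 0"
    using assms(2) by (auto intro: Nat.gr0I)
  then show ?thesis
    using qpoch_dissect[OF norm_power_less_one[OF assms(1)], of m k "q ^ a"] assms(2)
    by (simp flip: power_mult power_add)
qed

text \<open>The two-variable identity at w = q^5, z = q^k. The bound on \<open>k\<close> keeps z in
  the annulus, as |q|^15 < |q|^k <= 1. Quotients are kept since k = 7 produces negative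
  exponents.\<close>

lemma theta_identity_q5:
  assumes "q \<noteq> 0" "norm q < 1" and "k < 15"
  shows "theta (q ^ 5 / q ^ k) (q ^ 15) * theta (q ^ (20 + 4 * k)) (q ^ 60)
     - q ^ k * theta (q ^ (5 + k)) (q ^ 15) * theta (q ^ 20 / q ^ (4 * k)) (q ^ 60)
    = theta (q ^ 5) (q ^ 30) * theta (q ^ 20) (q ^ 60) *
      (theta (q ^ k) (q ^ 5) * theta (q ^ 15 / q ^ (2 * k)) (q ^ 30))"
proof -
  have "norm q ^ 15 < norm q ^ k"
    using assms by (intro power_strict_decreasing) auto
  then have 1: "norm (q ^ 5) ^ 3 < norm (q ^ k)"
    by (simp add: norm_power flip: power_mult)
  have "norm (q ^ k) \<le> 1"
    using assms by (simp add: norm_power power_le_one)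
  also have "1 < 1 / norm (q ^ 5)"
    using assms norm_power_less_one[of q 5] by simp
  finally have "theta_lhs (q ^ 5) (q ^ k) = theta (q ^ 5) ((q ^ 5) ^ 6) * theta ((q ^ 5) ^ 4) ((q ^ 5) ^ 12)
      * theta_rhs (q ^ 5) (q ^ k)"
    using assms 1 by (intro theta_two_variable_identity norm_power_less_one) auto
  then show ?thesis
    unfolding theta_lhs_def theta_rhs_def by (simp add: mult.commute add.commute flip: power_mult power_add)
qed

text \<open>For residues between 1 and 59 this is the reciprocal of the generating function of
  partitions into parts with residue in \<open>X\<close> modulo 60.\<close>

definition residue_prod :: "complex \<Rightarrow> nat set \<Rightarrow> complex" where
  "residue_prod q X = (\<Prod>r\<in>X. qpoch (q ^ r) (q ^ 60))"

text \<open>Each of the two symbols of base \<open>q ^ m\<close> splits into \<open>k\<close>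
  symbols of base \<open>q ^ 60\<close>. The condition \<open>2 * a \<noteq> m\<close> keeps the
  classes of a and m - a apart.\<close>

lemma theta_power_residue_prod:
  assumes q: "q \<noteq> 0" "norm q < 1" and m: "m * k = 60" and a: "0 < a" "a < m" "2 * a \<noteq> m"
    and X: "X = (\<lambda>j. a + m * j) ` {..<k} \<union> (\<lambda>j. m - a + m * j) ` {..<k}"
  shows "theta (q ^ a) (q ^ m) = residue_prod q X"
proof -
  have "m > 0"
    using a by simp
  then have inj: "inj_on (\<lambda>j. b + m * j) {..<k}" for b
    by (auto simp: inj_on_def)
  have "a + m * i \<noteq> m - a + m * j" for i j
  proof
    assume "a + m * i = m - a + m * j"
    then have "(a + m * i) mod m = (m - a + m * j) mod m"
      by (rule arg_cong)
    then have "a mod m = (m - a) mod m"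
      by (simp only: mod_mult_self2)
    then show False
      using a by simp
  qed
  then have disj: "(\<lambda>j. a + m * j) ` {..<k} \<inter> (\<lambda>j. m - a + m * j) ` {..<k} = {}"
    by fast
  have "theta (q ^ a) (q ^ m) = qpoch (q ^ a) (q ^ m) * qpoch (q ^ (m - a)) (q ^ m)"
    using q a by (simp add: theta_def power_diff)
  also have "\<dots> = residue_prod q ((\<lambda>j. a + m * j) ` {..<k}) * residue_prod q ((\<lambda>j. m - a + m * j) ` {..<k})"
    by (simp add: residue_prod_def prod.reindex[OF inj] qpoch_power_dissect_60[OF q(2) m])
  also have "\<dots> = residue_prod q X"
    unfolding residue_prod_def X using disj by (intro prod.union_disjoint[symmetric]) auto
  finally show ?thesis .
qed

lemma residue_prod_Un:
  "finite X \<Longrightarrow> finite Y \<Longrightarrow> X \<inter> Y = {} \<Longrightarrow> residue_prod q (X \<union> Y) = residue_prod q X * residue_prod q Y"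
  unfolding residue_prod_def by (rule prod.union_disjoint)

lemma residue_prod_nonzero:
  assumes "norm q < 1" and "X \<subseteq> {1..<60}"
  shows "residue_prod q X \<noteq> 0"
proof -
  have "qpoch (q ^ r) (q ^ 60) \<noteq> 0" if "r \<in> X" for r
    using that assms by (intro qpoch_nonzero_if_norm_less_1 norm_power_less_one) auto
  then show ?thesis
    using finite_subset[OF assms(2)] by (simp add: residue_prod_def)
qed

text \<open>\<open>D\<close> is the factor shared by both terms on the left, \<open>C\<close> the
  residues shared by the two sets of parts. Cancelling \<open>D\<close> and dividing by the products
  over \<open>S\<close>, \<open>T\<close> and \<open>C\<close> gives the claim.\<close>

lemma shifted_identity_of_theta_identity:
  assumes q: "norm q < 1"
    and sets: "D \<union> S \<union> T \<union> C \<subseteq> {1..<60}"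
    and disj: "D \<inter> S = {}" "D \<inter> T = {}" "D \<inter> C = {}" "S \<inter> T = {}" "S \<inter> C = {}" "T \<inter> C = {}"
    and eq: "residue_prod q (D \<union> T) - x * residue_prod q (D \<union> S) = residue_prod q (D \<union> S \<union> T \<union> C)"
  shows "inverse (residue_prod q (S \<union> C)) - x * inverse (residue_prod q (T \<union> C)) = 1"
proof -
  have fin: "finite D" "finite S" "finite T" "finite C"
    using finite_subset[OF sets] by auto
  have nz: "residue_prod q D \<noteq> 0" "residue_prod q S \<noteq> 0" "residue_prod q T \<noteq> 0" "residue_prod q C \<noteq> 0"
    using sets by (auto intro!: residue_prod_nonzero[OF q])
  have "residue_prod q D * (residue_prod q T - x * residue_prod q S)
      = residue_prod q D * (residue_prod q S * residue_prod q T * residue_prod q C)"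
    using eq fin disj by (simp add: residue_prod_Un Int_Un_distrib2 algebra_simps)
  then have "residue_prod q T - x * residue_prod q S = residue_prod q S * residue_prod q T * residue_prod q C"
    using nz(1) by simp
  then show ?thesis
    using nz fin disj by (simp add: residue_prod_Un field_simps)
qed

lemma num_partitions_pm_residues_shift:
  assumes RS: "R1 \<subseteq> {1..59}" "nat ` R1 \<union> nat ` (\<lambda>r. 60 - r) ` R1 = S \<union> C"
    and RT: "R2 \<subseteq> {1..59}" "nat ` R2 \<union> nat ` (\<lambda>r. 60 - r) ` R2 = T \<union> C"
    and sets: "D \<union> S \<union> T \<union> C \<subseteq> {1..<60}"
    and disj: "D \<inter> S = {}" "D \<inter> T = {}" "D \<inter> C = {}" "S \<inter> T = {}" "S \<inter> C = {}" "T \<inter> C = {}"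
    and "a > 0" and "n \<ge> a"
    and eq: "\<And>q. q \<noteq> 0 \<Longrightarrow> norm q < 1 \<Longrightarrow>
      residue_prod q (D \<union> T) - q ^ a * residue_prod q (D \<union> S) = residue_prod q (D \<union> S \<union> T \<union> C)"
  shows "num_partitions (pm_residues R1 60) n = num_partitions (pm_residues R2 60) (n - a)"
  unfolding pm_residues_60_eq[OF RS(1) RS(2)[symmetric]] pm_residues_60_eq[OF RT(1) RT(2)[symmetric]]
proof (rule num_partitions_shift)
  show "S \<union> C \<subseteq> {1..<60}" "T \<union> C \<subseteq> {1..<60}"
    using sets by auto
  show "inverse (\<Prod>r\<in>S \<union> C. qpoch (q ^ r) (q ^ 60)) - q ^ a * inverse (\<Prod>r\<in>T \<union> C. qpoch (q ^ r) (q ^ 60)) = 1"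
    if "q \<noteq> 0" "norm q < 1" for q
    using shifted_identity_of_theta_identity[OF that(2) sets disj eq[OF that]] by (simp add: residue_prod_def)
qed fact+

text \<open>The specialisations k = 1, 7, 4, 2, in this order, with all exponents made
  nonnegative.\<close>

lemma theta_product_identities:
  assumes q: "q \<noteq> 0" "norm q < 1"
  defines "c \<equiv> theta (q ^ 5) (q ^ 30) * theta (q ^ 20) (q ^ 60)"
  shows "theta (q ^ 4) (q ^ 15) * theta (q ^ 24) (q ^ 60) - q ^ 1 * (theta (q ^ 6) (q ^ 15) * theta (q ^ 16) (q ^ 60))
      = c * (theta (q ^ 1) (q ^ 5) * theta (q ^ 13) (q ^ 30))"
    and "theta (q ^ 2) (q ^ 15) * theta (q ^ 48) (q ^ 60) - q ^ 1 * (theta (q ^ 12) (q ^ 15) * theta (q ^ 8) (q ^ 60))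
      = c * (theta (q ^ 2) (q ^ 5) * theta (q ^ 1) (q ^ 30))"
    and "theta (q ^ 1) (q ^ 15) * theta (q ^ 36) (q ^ 60) - q ^ 4 * (theta (q ^ 9) (q ^ 15) * theta (q ^ 4) (q ^ 60))
      = c * (theta (q ^ 4) (q ^ 5) * theta (q ^ 7) (q ^ 30))"
    and "theta (q ^ 3) (q ^ 15) * theta (q ^ 28) (q ^ 60) - q ^ 2 * (theta (q ^ 7) (q ^ 15) * theta (q ^ 12) (q ^ 60))
      = c * (theta (q ^ 2) (q ^ 5) * theta (q ^ 11) (q ^ 30))"
proof -
  have quot: "q ^ i / q ^ j = q ^ (i - j)" if "j \<le> i" for i j
    using power_diff[OF q(1) that] by simp
  show "theta (q ^ 4) (q ^ 15) * theta (q ^ 24) (q ^ 60) - q ^ 1 * (theta (q ^ 6) (q ^ 15) * theta (q ^ 16) (q ^ 60))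
      = c * (theta (q ^ 1) (q ^ 5) * theta (q ^ 13) (q ^ 30))"
    using theta_identity_q5[OF q, of 1] quot[of 1 5] quot[of 4 20] quot[of 2 15] by (simp add: c_def mult.assoc)
  show "theta (q ^ 1) (q ^ 15) * theta (q ^ 36) (q ^ 60) - q ^ 4 * (theta (q ^ 9) (q ^ 15) * theta (q ^ 4) (q ^ 60))
      = c * (theta (q ^ 4) (q ^ 5) * theta (q ^ 7) (q ^ 30))"
    using theta_identity_q5[OF q, of 4] quot[of 4 5] quot[of 16 20] quot[of 8 15] by (simp add: c_def mult.assoc)
  show "theta (q ^ 3) (q ^ 15) * theta (q ^ 28) (q ^ 60) - q ^ 2 * (theta (q ^ 7) (q ^ 15) * theta (q ^ 12) (q ^ 60))
      = c * (theta (q ^ 2) (q ^ 5) * theta (q ^ 11) (q ^ 30))"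
    using theta_identity_q5[OF q, of 2] quot[of 2 5] quot[of 8 20] quot[of 4 15] by (simp add: c_def mult.assoc)
  \<comment> \<open>For k = 7 two arguments are negative powers of q, and \<open>q ^ 7\<close>
    exceeds the nome \<open>q ^ 5\<close>. Two inversions and one shift repair this and leave the
    common factor -1/q^2 on both sides.\<close>
  have "q ^ 5 / q ^ 7 = 1 / q ^ 2" "q ^ 20 / q ^ 28 = 1 / q ^ 8"
    using q by (simp_all add: field_simps flip: power_add)
  then have inv: "theta (q ^ 5 / q ^ 7) (q ^ 15) = - theta (q ^ 2) (q ^ 15) / q ^ 2"
    "theta (q ^ 20 / q ^ 28) (q ^ 60) = - theta (q ^ 8) (q ^ 60) / q ^ 8"
    using theta_inverse[of "q ^ 15" "q ^ 2"] theta_inverse[of "q ^ 60" "q ^ 8"] q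
    by (simp_all add: norm_power_less_one)
  have "theta (q ^ 7) (q ^ 5) = - theta (q ^ 2) (q ^ 5) / q ^ 2"
    using theta_shift[of "q ^ 5" "q ^ 2"] q by (simp add: norm_power_less_one flip: power_add)
  then have "- theta (q ^ 2) (q ^ 15) / q ^ 2 * theta (q ^ 48) (q ^ 60)
      - q ^ 7 * theta (q ^ 12) (q ^ 15) * (- theta (q ^ 8) (q ^ 60) / q ^ 8)
      = c * (- theta (q ^ 2) (q ^ 5) / q ^ 2 * theta (q ^ 1) (q ^ 30))"
    using theta_identity_q5[OF q, of 7] quot[of 14 15] inv by (simp add: c_def mult.assoc)
  moreover have "A * B - q ^ 1 * (X * Y) = c * (E * F)"
    if "- A / q ^ 2 * B - q ^ 7 * X * (- Y / q ^ 8) = c * (- E / q ^ 2 * F)" for A B X Y E F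
  proof -
    have "- A / q ^ 2 * B - q ^ 7 * X * (- Y / q ^ 8) = - (A * B - q ^ 1 * (X * Y)) / q ^ 2"
      using q by (simp add: field_simps eval_nat_numeral)
    moreover have "c * (- E / q ^ 2 * F) = - (c * (E * F)) / q ^ 2"
      by simp
    ultimately have "- (A * B - q ^ 1 * (X * Y)) / q ^ 2 = - (c * (E * F)) / q ^ 2"
      using that by simp
    then show ?thesis
      using q by (simp only: divide_cancel_right neg_equal_iff_equal) simp
  qed
  ultimately show "theta (q ^ 2) (q ^ 15) * theta (q ^ 48) (q ^ 60) - q ^ 1 * (theta (q ^ 12) (q ^ 15) * theta (q ^ 8) (q ^ 60))
      = c * (theta (q ^ 2) (q ^ 5) * theta (q ^ 1) (q ^ 30))"
    by blast
qed

section \<open>Residue classes modulo 60 of the theta functions\<close>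

lemma theta_residue_prod_60:
  assumes q: "q \<noteq> 0" "norm q < 1"
  shows "theta (q ^ 4) (q ^ 60) = residue_prod q {4, 56}"
    and "theta (q ^ 8) (q ^ 60) = residue_prod q {8, 52}"
    and "theta (q ^ 12) (q ^ 60) = residue_prod q {12, 48}"
    and "theta (q ^ 16) (q ^ 60) = residue_prod q {16, 44}"
    and "theta (q ^ 20) (q ^ 60) = residue_prod q {20, 40}"
    and "theta (q ^ 24) (q ^ 60) = residue_prod q {24, 36}"
    and "theta (q ^ 28) (q ^ 60) = residue_prod q {28, 32}"
    and "theta (q ^ 36) (q ^ 60) = residue_prod q {24, 36}"
    and "theta (q ^ 48) (q ^ 60) = residue_prod q {12, 48}"
  by (rule theta_power_residue_prod[OF q, where k = 1];
      auto simp: lessThan_nat_numeral lessThan_Suc)+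

lemma theta_residue_prod_30:
  assumes q: "q \<noteq> 0" "norm q < 1"
  shows "theta (q ^ 1) (q ^ 30) = residue_prod q {1, 29, 31, 59}"
    and "theta (q ^ 5) (q ^ 30) = residue_prod q {5, 25, 35, 55}"
    and "theta (q ^ 7) (q ^ 30) = residue_prod q {7, 23, 37, 53}"
    and "theta (q ^ 11) (q ^ 30) = residue_prod q {11, 19, 41, 49}"
    and "theta (q ^ 13) (q ^ 30) = residue_prod q {13, 17, 43, 47}"
  by (rule theta_power_residue_prod[OF q, where k = 2];
      auto simp: lessThan_nat_numeral lessThan_Suc)+

lemma theta_residue_prod_15:
  assumes q: "q \<noteq> 0" "norm q < 1"
  shows "theta (q ^ 1) (q ^ 15) = residue_prod q {1, 14, 16, 29, 31, 44, 46, 59}"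
    and "theta (q ^ 2) (q ^ 15) = residue_prod q {2, 13, 17, 28, 32, 43, 47, 58}"
    and "theta (q ^ 3) (q ^ 15) = residue_prod q {3, 12, 18, 27, 33, 42, 48, 57}"
    and "theta (q ^ 4) (q ^ 15) = residue_prod q {4, 11, 19, 26, 34, 41, 49, 56}"
    and "theta (q ^ 6) (q ^ 15) = residue_prod q {6, 9, 21, 24, 36, 39, 51, 54}"
    and "theta (q ^ 7) (q ^ 15) = residue_prod q {7, 8, 22, 23, 37, 38, 52, 53}"
    and "theta (q ^ 9) (q ^ 15) = residue_prod q {6, 9, 21, 24, 36, 39, 51, 54}"
    and "theta (q ^ 12) (q ^ 15) = residue_prod q {3, 12, 18, 27, 33, 42, 48, 57}"
  by (rule theta_power_residue_prod[OF q, where k = 4];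
      auto simp: lessThan_nat_numeral lessThan_Suc)+

lemma theta_residue_prod_5:
  assumes q: "q \<noteq> 0" "norm q < 1"
  shows "theta (q ^ 1) (q ^ 5) = residue_prod q {1, 4, 6, 9, 11, 14, 16, 19, 21, 24, 26, 29, 31, 34, 36, 39, 41, 44, 46, 49, 51, 54, 56, 59}"
    and "theta (q ^ 2) (q ^ 5) = residue_prod q {2, 3, 7, 8, 12, 13, 17, 18, 22, 23, 27, 28, 32, 33, 37, 38, 42, 43, 47, 48, 52, 53, 57, 58}"
    and "theta (q ^ 4) (q ^ 5) = residue_prod q {1, 4, 6, 9, 11, 14, 16, 19, 21, 24, 26, 29, 31, 34, 36, 39, 41, 44, 46, 49, 51, 54, 56, 59}"
  by (rule theta_power_residue_prod[OF q, where k = 12];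
      auto simp: lessThan_nat_numeral lessThan_Suc)+

lemmas theta_residue_prod =
  theta_residue_prod_60 theta_residue_prod_30 theta_residue_prod_15 theta_residue_prod_5

section \<open>The four cases\<close>

lemma num_partitions_shift_i:
  assumes "n \<ge> 1"
  shows "num_partitions (pm_residues {1, 5, 6, 9, 13, 14, 16, 17, 20, 21, 25, 29} 60) n =
    num_partitions (pm_residues {1, 4, 5, 11, 13, 14, 17, 19, 20, 25, 26, 29} 60) (n - 1)"
\<comment> \<open>The residues 24 and 36 of theta at \<open>q ^ 24\<close> recur in theta at
  \<open>q ^ 6\<close> of nome \<open>q ^ 15\<close>, so they form \<open>D\<close>.
  \<open>C\<close> is the intersection of the two residue sets, \<open>S\<close> and
  \<open>T\<close> what remains of them.\<close>
proof (rule num_partitions_pm_residues_shift[where D = "{24, 36}" and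
      S = "{6, 9, 16, 21, 39, 44, 51, 54}" and
      T = "{4, 11, 19, 26, 34, 41, 49, 56}" and
      C = "{1, 5, 13, 14, 17, 20, 25, 29, 31, 35, 40, 43, 46, 47, 55, 59}"])
  fix q :: complex
  assume q: "q \<noteq> 0" "norm q < 1"
  show "residue_prod q ({24, 36} \<union> {4, 11, 19, 26, 34, 41, 49, 56})
      - q ^ 1 * residue_prod q ({24, 36} \<union> {6, 9, 16, 21, 39, 44, 51, 54})
      = residue_prod q ({24, 36} \<union> {6, 9, 16, 21, 39, 44, 51, 54}
        \<union> {4, 11, 19, 26, 34, 41, 49, 56}
        \<union> {1, 5, 13, 14, 17, 20, 25, 29, 31, 35, 40, 43, 46, 47, 55, 59})"
    using theta_product_identities(1)[OF q] unfolding theta_residue_prod[OF q]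
    by (simp add: residue_prod_def mult_ac)
qed (use assms in auto)

lemma num_partitions_shift_ii:
  assumes "n \<ge> 1"
  shows "num_partitions (pm_residues {1, 3, 5, 7, 8, 18, 20, 22, 23, 25, 27, 29} 60) n =
    num_partitions (pm_residues {1, 2, 5, 7, 13, 17, 20, 22, 23, 25, 28, 29} 60) (n - 1)"
proof (rule num_partitions_pm_residues_shift[where D = "{12, 48}" and
      S = "{3, 8, 18, 27, 33, 42, 52, 57}" and
      T = "{2, 13, 17, 28, 32, 43, 47, 58}" and
      C = "{1, 5, 7, 20, 22, 23, 25, 29, 31, 35, 37, 38, 40, 53, 55, 59}"])
  fix q :: complex
  assume q: "q \<noteq> 0" "norm q < 1"
  show "residue_prod q ({12, 48} \<union> {2, 13, 17, 28, 32, 43, 47, 58})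
      - q ^ 1 * residue_prod q ({12, 48} \<union> {3, 8, 18, 27, 33, 42, 52, 57})
      = residue_prod q ({12, 48} \<union> {3, 8, 18, 27, 33, 42, 52, 57}
        \<union> {2, 13, 17, 28, 32, 43, 47, 58}
        \<union> {1, 5, 7, 20, 22, 23, 25, 29, 31, 35, 37, 38, 40, 53, 55, 59})"
    using theta_product_identities(2)[OF q] unfolding theta_residue_prod[OF q]
    by (simp add: residue_prod_def mult_ac)
qed (use assms in auto)

lemma num_partitions_shift_iii:
  assumes "n \<ge> 4"
  shows "num_partitions (pm_residues {4, 5, 6, 7, 9, 11, 19, 20, 21, 23, 25, 26} 60) n =
    num_partitions (pm_residues {1, 5, 7, 11, 14, 16, 19, 20, 23, 25, 26, 29} 60) (n - 4)"
proof (rule num_partitions_pm_residues_shift[where D = "{24, 36}" and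
      S = "{4, 6, 9, 21, 39, 51, 54, 56}" and
      T = "{1, 14, 16, 29, 31, 44, 46, 59}" and
      C = "{5, 7, 11, 19, 20, 23, 25, 26, 34, 35, 37, 40, 41, 49, 53, 55}"])
  fix q :: complex
  assume q: "q \<noteq> 0" "norm q < 1"
  show "residue_prod q ({24, 36} \<union> {1, 14, 16, 29, 31, 44, 46, 59})
      - q ^ 4 * residue_prod q ({24, 36} \<union> {4, 6, 9, 21, 39, 51, 54, 56})
      = residue_prod q ({24, 36} \<union> {4, 6, 9, 21, 39, 51, 54, 56}
        \<union> {1, 14, 16, 29, 31, 44, 46, 59}
        \<union> {5, 7, 11, 19, 20, 23, 25, 26, 34, 35, 37, 40, 41, 49, 53, 55})"
    using theta_product_identities(3)[OF q] unfolding theta_residue_prod[OF q]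
    by (simp add: residue_prod_def mult_ac)
qed (use assms in auto)

lemma num_partitions_shift_iv:
  assumes "n \<ge> 2"
  shows "num_partitions (pm_residues {2, 5, 7, 8, 11, 13, 17, 19, 20, 22, 23, 25} 60) n =
    num_partitions (pm_residues {2, 3, 5, 11, 13, 17, 18, 19, 20, 25, 27, 28} 60) (n - 2)"
\<comment> \<open>Unlike in the other cases, \<open>D\<close> here lies inside the nome
  \<open>q ^ 15\<close> factor of the first term and is the whole nome \<open>q ^ 60\<close> factor
  of the second.\<close>
proof (rule num_partitions_pm_residues_shift[where D = "{12, 48}" and
      S = "{7, 8, 22, 23, 37, 38, 52, 53}" and
      T = "{3, 18, 27, 28, 32, 33, 42, 57}" and
      C = "{2, 5, 11, 13, 17, 19, 20, 25, 35, 40, 41, 43, 47, 49, 55, 58}"])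
  fix q :: complex
  assume q: "q \<noteq> 0" "norm q < 1"
  show "residue_prod q ({12, 48} \<union> {3, 18, 27, 28, 32, 33, 42, 57})
      - q ^ 2 * residue_prod q ({12, 48} \<union> {7, 8, 22, 23, 37, 38, 52, 53})
      = residue_prod q ({12, 48} \<union> {7, 8, 22, 23, 37, 38, 52, 53}
        \<union> {3, 18, 27, 28, 32, 33, 42, 57}
        \<union> {2, 5, 11, 13, 17, 19, 20, 25, 35, 40, 41, 43, 47, 49, 55, 58})"
    using theta_product_identities(4)[OF q] unfolding theta_residue_prod[OF q]
    by (simp add: residue_prod_def mult_ac)
qed (use assms in auto)

theorem theorem12p4:
  shows "(let S = pm_residues {1, 5, 6, 9, 13, 14, 16, 17, 20, 21, 25, 29} 60;
            T = pm_residues {1, 4, 5, 11, 13, 14, 17, 19, 20, 25, 26, 29} 60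
        in \<forall>n\<ge>1. num_partitions S n = num_partitions T (n - 1))
   \<and> (let S = pm_residues {1, 3, 5, 7, 8, 18, 20, 22, 23, 25, 27, 29} 60;
            T = pm_residues {1, 2, 5, 7, 13, 17, 20, 22, 23, 25, 28, 29} 60
        in \<forall>n\<ge>1. num_partitions S n = num_partitions T (n - 1))
   \<and> (let S = pm_residues {4, 5, 6, 7, 9, 11, 19, 20, 21, 23, 25, 26} 60;
            T = pm_residues {1, 5, 7, 11, 14, 16, 19, 20, 23, 25, 26, 29} 60
        in \<forall>n\<ge>4. num_partitions S n = num_partitions T (n - 4))
   \<and> (let S = pm_residues {2, 5, 7, 8, 11, 13, 17, 19, 20, 22, 23, 25} 60;
            T = pm_residues {2, 3, 5, 11, 13, 17, 18, 19, 20, 25, 27, 28} 60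
        in \<forall>n\<ge>2. num_partitions S n = num_partitions T (n - 2))"
  unfolding Let_def
  using num_partitions_shift_i num_partitions_shift_ii num_partitions_shift_iii num_partitions_shift_iv
  by blast

end
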